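(* Let $K$ be a perfect field of characteristic $p>0$ and let $F$ be an algebraic function field of transcendence degree $1$ over $K$. If $K$ is relatively algebraically closed in $F$, then there exists a Frobenius-closed basis for $F|K$.
   Context: An algebraic function field $F|K$ is a finitely generated field extension of $K$. For an extension $F|K$ of fields of characteristic $p>0$, a basis $B$ of the $K$-vector space $F$ is called Frobenius-closed if $B^p\subset B$, where $B^p=\{b^p\mid b\in B\}$. *)

theory Defs
  imports
    "HOL-Computational_Algebra.Computational_Algebra"
    "HOL-Library.Poly_Mapping"
begin

text \<open>
  Lang's and Bourbaki's definition: a field is perfect if it has characteristic zero or if
  it has characteristic \<open>p > 0\<close> and each of its elements is a \<open>p\<close>-th power.
\<close>

definition perfect_field :: "'k::field itself \<Rightarrow> bool"
  where "perfect_field (_ :: 'k itself) \<longleftrightarrow>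
    CHAR('k) = 0 \<or> surj (\<lambda>x::'k. x ^ CHAR('k))"

definition is_subfield :: "'f::field set \<Rightarrow> bool"
  where "is_subfield L \<longleftrightarrow>
    1 \<in> L \<and> (\<forall>x\<in>L. \<forall>y\<in>L. x - y \<in> L \<and> x * y \<in> L) \<and> (\<forall>x\<in>L. inverse x \<in> L)"

definition algebraic_over :: "'f::field set \<Rightarrow> 'f \<Rightarrow> bool"
  where "algebraic_over L x \<longleftrightarrow>
    (\<exists>q::'f poly. q \<noteq> 0 \<and> (\<forall>i. coeff q i \<in> L) \<and> poly q x = 0)"

text \<open>
  A field extension \<open>F|K\<close> is given by an embedding of the field \<open>K\<close>, the type \<open>'k\<close>,
  into the field \<open>F\<close>, the type \<open>'f\<close>; the subfield \<open>K\<close> of \<open>F\<close> is then \<open>range emb\<close>.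
\<close>

locale field_extension =
  fixes emb :: "'k::field \<Rightarrow> 'f::field"
  assumes emb_add: "emb (x + y) = emb x + emb y"
    and emb_mult: "emb (x * y) = emb x * emb y"
    and emb_one: "emb 1 = 1"
begin

sublocale vector_space "\<lambda>c x. emb c * x"
  by unfold_locales (simp_all add: emb_add emb_mult emb_one algebra_simps)

definition is_basis :: "'f set \<Rightarrow> bool"
  where "is_basis B \<longleftrightarrow> independent B \<and> span B = UNIV"

definition adjoin :: "'f set \<Rightarrow> 'f set"
  where "adjoin S = is_subfield hull (range emb \<union> S)"

definition finitely_generated :: bool
  where "finitely_generated \<longleftrightarrow> (\<exists>S. finite S \<and> adjoin S = UNIV)"

text \<open>
  A polynomial over \<open>K\<close> in variables indexed by elements of \<open>F\<close> is a finitely supported map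
  from monomials to coefficients, a monomial being a finitely supported map from variables to
  exponents. Each variable is evaluated at the element of \<open>F\<close> that it is indexed by.
\<close>

definition poly_eval :: "(('f \<Rightarrow>\<^sub>0 nat) \<Rightarrow>\<^sub>0 'k) \<Rightarrow> 'f"
  where "poly_eval P =
    (\<Sum>m\<in>Poly_Mapping.keys P. emb (Poly_Mapping.lookup P m) *
      (\<Prod>s\<in>Poly_Mapping.keys m. s ^ Poly_Mapping.lookup m s))"

definition algebraically_independent :: "'f set \<Rightarrow> bool"
  where "algebraically_independent S \<longleftrightarrow>
    (\<forall>P. (\<forall>m\<in>Poly_Mapping.keys P. Poly_Mapping.keys m \<subseteq> S) \<and> poly_eval P = 0 \<longrightarrow> P = 0)"

definition transcendence_basis :: "'f set \<Rightarrow> bool"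
  where "transcendence_basis S \<longleftrightarrow>
    algebraically_independent S \<and> (\<forall>x. algebraic_over (adjoin S) x)"

definition has_transcendence_degree :: "nat \<Rightarrow> bool"
  where "has_transcendence_degree n \<longleftrightarrow>
    (\<exists>S. transcendence_basis S \<and> finite S \<and> card S = n)"

definition relatively_algebraically_closed :: bool
  where "relatively_algebraically_closed \<longleftrightarrow>
    (\<forall>x. algebraic_over (range emb) x \<longrightarrow> x \<in> range emb)"

end

definition frobenius_closed :: "nat \<Rightarrow> 'f::field set \<Rightarrow> bool"
  where "frobenius_closed p B \<longleftrightarrow> (\<lambda>b. b ^ p) ` B \<subseteq> B"

end

theory Submission
  imports Defs
begin

text \<open>
  Suppose that \<open>F\<close> carries an index with values in a well-order that is ultrametric, does not
  increase under multiplication by \<open>K\<close>, and increases strictly under \<open>y \<mapsto> y\<^sup>p\<close> for \<open>y \<notin> K\<close>.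
  Refine it to a well-order of \<open>F\<close> and let \<open>C\<close> consist of the elements \<open>x\<close> that are not in the
  span of the smaller elements and of the \<open>p\<close>-th powers of index at most that of \<open>x\<close>. Then \<open>C\<close>
  is linearly independent modulo \<open>F\<^sup>p\<close>, and \<open>1\<close> together with all iterated \<open>p\<close>-th powers of
  elements of \<open>C\<close> is a basis: it spans by well-founded induction, because
  \<open>x = c + y\<^sup>p\<close> up to smaller elements, where \<open>y\<close> itself is smaller than \<open>x\<close> or in \<open>K\<close>.

  To get the index, write \<open>F\<close> as a finite extension of \<open>K(t)\<close>. For a place \<open>v\<close> of \<open>K(t)\<close>, a
  suitably scaled largest pole order at the places above \<open>v\<close> is a natural number that is
  ultrametric and increases strictly under \<open>y \<mapsto> y\<^sup>p\<close> unless it is \<open>0\<close>. An element has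
  poles above only finitely many \<open>v\<close>, and above none only if it is algebraic over \<open>K\<close>, that is,
  in \<open>K\<close>. After well-ordering the places, the index is the largest \<open>v\<close> above which
  there is a pole, followed by the pole order there.
\<close>

section \<open>Frobenius-closed bases from an ultrametric index\<close>

context field_extension
begin

section \<open>Field embeddings and the characteristic\<close>

lemma emb_0 [simp]: "emb 0 = 0"
  using emb_add[of 0 0] by (metis add_0 add_cancel_right_right)

lemma emb_minus: "emb (- x) = - emb x"
  using emb_add[of "- x" x] by (simp add: eq_neg_iff_add_eq_0)

lemma emb_power: "emb (x ^ n) = emb x ^ n"
  by (induction n) (simp_all add: emb_one emb_mult)

lemma emb_eq_0_iff [simp]: "emb x = 0 \<longleftrightarrow> x = 0"
proof
  assume "emb x = 0"
  then have "x \<noteq> 0 \<Longrightarrow> emb (x * inverse x) = 0" by (simp only: emb_mult mult_zero_left)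
  then show "x = 0" by (metis emb_one right_inverse zero_neq_one)
qed simp

lemma emb_inverse: "emb (inverse x) = inverse (emb x)"
proof (cases "x = 0")
  case False
  then have "emb (inverse x) * emb x = 1"
    by (metis emb_mult emb_one left_inverse)
  then show ?thesis by (metis inverse_unique mult.commute)
qed simp

lemma emb_of_nat: "emb (of_nat n) = of_nat n"
  by (induction n) (simp_all add: emb_add emb_one)

lemma CHAR_eq: "CHAR('f) = CHAR('k)"
proof (rule CHAR_eqI)
  show "of_nat CHAR('k) = (0 :: 'f)"
    using emb_of_nat[of "CHAR('k)"] by simp
  show "CHAR('k) dvd n" if "of_nat n = (0 :: 'f)" for n
  proof -
    have "(of_nat n :: 'k) = 0"
      by (metis emb_of_nat that emb_eq_0_iff)
    then show ?thesis by (simp add: of_nat_eq_0_iff_char_dvd)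
  qed
qed

end

locale frobenius_extension = field_extension emb
  for emb :: "'k::field \<Rightarrow> 'f::field" +
  fixes p :: nat
  assumes char_p: "CHAR('k) = p" and p_pos: "p > 0"
    and perfect: "perfect_field TYPE('k)"
begin

section \<open>The Frobenius map over a perfect base field\<close>

lemma prime_p: "prime p"
  using prime_CHAR_semidom[where 'a = 'k] char_p p_pos by simp

lemma p_ge_2: "p \<ge> 2"
  using prime_p by (rule prime_ge_2_nat)

lemma frob_add: "(x + y :: 'f) ^ p = x ^ p + y ^ p"
  by (rule freshmans_dream) (simp_all add: CHAR_eq char_p prime_p)

lemma frob_sum: "(\<Sum>i\<in>A. f i :: 'f) ^ p = (\<Sum>i\<in>A. f i ^ p)"
  using p_pos by (induction A rule: infinite_finite_induct) (simp_all add: frob_add)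

lemma frob_eq_iff: "(x :: 'f) ^ p = y ^ p \<longleftrightarrow> x = y"
proof
  assume "x ^ p = y ^ p"
  moreover have "x ^ p = (x - y) ^ p + y ^ p"
    by (metis frob_add diff_add_cancel)
  ultimately show "x = y" by simp
qed simp

lemma frobenius_root: obtains b :: 'k where "b ^ p = a"
  using perfect p_pos unfolding perfect_field_def char_p by (metis surjD neq0_conv)

lemma frob_span:
  assumes closed: "\<And>b. b \<in> B \<Longrightarrow> b ^ p \<in> B" and "x \<in> span B"
  shows "x ^ p \<in> span B"
  using assms(2)
proof (induction rule: span_induct_alt)
  case base
  then show ?case using p_pos by (simp add: span_zero power_0_left)
next
  case (step c x y)
  have "(emb c * x + y) ^ p = emb (c ^ p) * x ^ p + y ^ p"
    by (simp add: frob_add power_mult_distrib emb_power)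
  then show ?case using step closed by (simp only: span_add span_scale span_base)
qed

text \<open>Perfectness lets each coefficient move inside the power as a \<open>p\<close>-th root,
  so the \<open>p\<close>-th powers form a \<open>K\<close>-subspace of \<open>F\<close>. The roots
  \<open>w\<close> are related to \<open>u\<close> so that vanishing can be transferred
  back.\<close>

lemma scaled_frob_sum:
  "\<exists>w. (\<Sum>b\<in>T. emb (u b) * b ^ p) = (\<Sum>b\<in>T. emb (w b) * b) ^ p \<and> (\<forall>b. w b ^ p = u b)"
proof -
  have "\<forall>b. \<exists>r. r ^ p = u b" using frobenius_root by metis
  then obtain w where w: "\<And>b. w b ^ p = u b" by metis
  have "(\<Sum>b\<in>T. emb (u b) * b ^ p) = (\<Sum>b\<in>T. emb (w b) * b) ^ p"
    by (simp add: frob_sum power_mult_distrib w flip: emb_power)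
  then show ?thesis using w by blast
qed

text \<open>The hypothesis on \<open>C\<close> is linear independence modulo the subspace of
  \<open>p\<close>-th powers. In a relation the \<open>C\<close>-part is therefore trivial, and what
  remains is the \<open>p\<close>-th power of a relation in \<open>B\<close>.\<close>

lemma independent_Un_frob:
  assumes C: "\<And>T u y. finite T \<Longrightarrow> T \<subseteq> C \<Longrightarrow> (\<Sum>c\<in>T. emb (u c) * c) = y ^ p \<Longrightarrow> \<forall>c\<in>T. u c = 0"
    and B: "independent B"
  shows "independent (C \<union> (\<lambda>b. b ^ p) ` B)"
  unfolding independent_explicit_module
proof safe
  fix T u v
  assume T: "finite T" "T \<subseteq> C \<union> (\<lambda>b. b ^ p) ` B" "(\<Sum>v\<in>T. emb (u v) * v) = 0" "v \<in> T"
  define T1 where "T1 = T \<inter> C"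
  define T2 where "T2 = {b\<in>B. b ^ p \<in> T - C}"
  have inj: "inj_on (\<lambda>b. b ^ p) T2" by (simp add: inj_on_def frob_eq_iff)
  have T_eq: "T = T1 \<union> (\<lambda>b. b ^ p) ` T2" and disj: "T1 \<inter> (\<lambda>b. b ^ p) ` T2 = {}"
    using T(2) by (auto simp: T1_def T2_def)
  have fin: "finite T1" "finite T2"
    using T(1) T_eq inj by (auto simp: finite_image_iff)
  have T2: "(\<Sum>v\<in>(\<lambda>b. b ^ p) ` T2. emb (u v) * v) = (\<Sum>b\<in>T2. emb (u (b ^ p)) * b ^ p)"
    by (simp add: sum.reindex[OF inj])
  obtain w where w: "(\<Sum>b\<in>T2. emb (u (b ^ p)) * b ^ p) = (\<Sum>b\<in>T2. emb (w b) * b) ^ p"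
    "\<And>b. w b ^ p = u (b ^ p)"
    using scaled_frob_sum[where T = T2 and u = "\<lambda>b. u (b ^ p)"] by blast
  have sum0: "(\<Sum>c\<in>T1. emb (u c) * c) + (\<Sum>b\<in>T2. emb (w b) * b) ^ p = 0"
    using T(3) fin disj by (simp add: T_eq sum.union_disjoint T2 w)
  \<comment> \<open>Additivity of Frobenius shows that the negative of a \<open>p\<close>-th power
    is a \<open>p\<close>-th power, whatever the parity of \<open>p\<close>.\<close>
  have "(\<Sum>b\<in>T2. emb (- w b) * b) ^ p + (\<Sum>b\<in>T2. emb (w b) * b) ^ p = 0"
    using p_pos by (simp add: emb_minus sum_negf flip: frob_add)
  then have "(\<Sum>c\<in>T1. emb (u c) * c) = (\<Sum>b\<in>T2. emb (- w b) * b) ^ p"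
    using sum0 by (metis add_right_imp_eq)
  then have 1: "\<forall>c\<in>T1. u c = 0" using C fin(1) by (simp add: T1_def)
  then have "(\<Sum>b\<in>T2. emb (w b) * b) ^ p = 0" using sum0 by simp
  then have "(\<Sum>b\<in>T2. emb (w b) * b) = 0" by simp
  then have "\<forall>b\<in>T2. w b = 0"
    using independentD[OF B fin(2)] by (auto simp: T2_def)
  then have "\<forall>b\<in>T2. u (b ^ p) = 0" using w(2) p_pos by (metis power_0_left neq0_conv)
  then show "u v = 0" using T(4) 1 T_eq by auto
qed

section \<open>Frobenius orbits\<close>

definition frobenius_orbits :: "'f set \<Rightarrow> 'f set"
  where "frobenius_orbits C = {1} \<union> (\<Union>n. (\<lambda>c. c ^ p ^ n) ` C)"

lemma frobenius_orbits_power: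
  assumes "b \<in> frobenius_orbits C"
  shows "b ^ p \<in> frobenius_orbits C"
proof -
  have "(c ^ p ^ n) ^ p = c ^ p ^ Suc n" for c :: 'f and n
    by (simp add: mult.commute flip: power_mult)
  then show ?thesis
    using assms unfolding frobenius_orbits_def by fastforce
qed

lemma frobenius_closed_orbits: "frobenius_closed p (frobenius_orbits C)"
  using frobenius_orbits_power by (auto simp: frobenius_closed_def)

text \<open>Each truncation \<open>B (Suc n)\<close> consists of \<open>C\<close> and the
  \<open>p\<close>-th powers of \<open>B n\<close>, so independence passes up from
  \<open>{1}\<close> by induction, and then to the union of the chain.\<close>

lemma independent_orbits:
  assumes C: "\<And>T u y. finite T \<Longrightarrow> T \<subseteq> C \<Longrightarrow> (\<Sum>c\<in>T. emb (u c) * c) = y ^ p \<Longrightarrow> \<forall>c\<in>T. u c = 0"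
  shows "independent (frobenius_orbits C)"
proof -
  define B where "B n = {1} \<union> (\<Union>m<n. (\<lambda>c. c ^ p ^ m) ` C)" for n :: nat
  have step: "B (Suc n) = C \<union> (\<lambda>b. b ^ p) ` B n" for n
  proof -
    have "(\<lambda>c. c ^ p ^ Suc m) ` C = (\<lambda>b. b ^ p) ` (\<lambda>c. c ^ p ^ m) ` C" for m
      by (simp add: image_image mult.commute flip: power_mult)
    then have "(\<Union>m<n. (\<lambda>c. c ^ p ^ Suc m) ` C) = (\<lambda>b. b ^ p) ` (\<Union>m<n. (\<lambda>c. c ^ p ^ m) ` C)"
      by (simp add: image_UN del: power_Suc)
    moreover have "(\<Union>m<Suc n. (\<lambda>c. c ^ p ^ m) ` C) = C \<union> (\<Union>m<n. (\<lambda>c. c ^ p ^ Suc m) ` C)"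
      by (simp add: lessThan_Suc_eq_insert_0 del: power_Suc)
    ultimately show ?thesis unfolding B_def by auto
  qed
  have indep: "independent (B n)" for n
  proof (induction n)
    case 0
    show ?case unfolding B_def by simp
  next
    case (Suc n)
    then show ?case unfolding step using independent_Un_frob C by blast
  qed
  have "B m \<subseteq> B n" if "m \<le> n" for m n
    using that unfolding B_def by force
  then have directed: "B m \<subseteq> B n \<or> B n \<subseteq> B m" for m n
    by (metis nle_le)
  have "independent (\<Union>n. B n)"
    by (rule independent_Union_directed) (use directed indep in blast)+
  moreover have "frobenius_orbits C = (\<Union>n. B n)"
    unfolding frobenius_orbits_def B_def by auto
  ultimately show ?thesis by simp
qed

theorem frobenius_basis_if_ultrametric:
  fixes idx :: "'f \<Rightarrow> 'i" and R :: "('i \<times> 'i) set"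
  assumes wf: "wf R" and trans: "trans R" and total: "total R"
    and ultra: "\<And>x y i. (idx x, i) \<in> R\<^sup>= \<Longrightarrow> (idx y, i) \<in> R\<^sup>= \<Longrightarrow> (idx (x + y), i) \<in> R\<^sup>="
    and scale: "\<And>c x. (idx (emb c * x), idx x) \<in> R\<^sup>="
    and power: "\<And>y. y \<notin> range emb \<Longrightarrow> (idx y, idx (y ^ p)) \<in> R"
  shows "\<exists>B. is_basis B \<and> frobenius_closed p B"
proof -
  \<comment> \<open>An arbitrary well-order breaks ties of the index, so that a nonempty finite set
    of elements has a single largest one.\<close>
  obtain r :: "'f rel" where r: "well_order_on UNIV r"
    using well_order_on by blast
  define L where "L = inv_image (R <*lex*> (r - Id)) (\<lambda>x. (idx x, x))"
  have L_iff: "(x, y) \<in> L \<longleftrightarrow> (idx x, idx y) \<in> R \<or> idx x = idx y \<and> (x, y) \<in> r - Id" for x y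
    by (simp add: L_def)
  have wf_r: "wf (r - Id)"
    using r by (simp add: well_order_on_def)
  have lin: "trans (r - Id)" "total (r - Id)"
    using r unfolding well_order_on_def linear_order_on_def partial_order_on_def preorder_on_def
    by (auto intro: trans_diff_Id simp: total_on_def)
  have wf_L: "wf L" unfolding L_def using wf wf_r by blast
  have total_L: "x \<noteq> y \<Longrightarrow> (x, y) \<in> L \<or> (y, x) \<in> L" for x y
    using total lin(2) unfolding L_iff total_on_def by blast
  have trans_L: "trans L"
    unfolding L_def using trans lin(1) by (intro trans_inv_image trans_lex_prod)
  have L_imp_R: "(x, y) \<in> L \<Longrightarrow> (idx x, idx y) \<in> R\<^sup>=" for x y
    by (auto simp: L_iff)
  \<comment> \<open>The bound on the \<open>p\<close>-th powers is non-strict: a \<open>p\<close>-th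
    power that equals a combination of elements of \<open>C\<close> may have the same index as the
    largest of them.\<close>
  define D where "D x = {y. (y, x) \<in> L} \<union> {y ^ p | y. (idx (y ^ p), idx x) \<in> R\<^sup>=}" for x
  define C where "C = {x. x \<notin> span (D x)}"
  have spanning: "x \<in> span (frobenius_orbits C)" for x
  proof (induction x rule: wf_induct_rule[OF wf_L])
    case (1 x)
    show ?case
    proof (cases "x \<in> C")
      case True
      then have "x \<in> (\<lambda>c. c ^ p ^ 0) ` C" by simp
      then have "x \<in> frobenius_orbits C" unfolding frobenius_orbits_def by blast
      then show ?thesis by (rule span_base)
    next
      case False
      have "D x \<subseteq> span (frobenius_orbits C)"
      proof
        fix z assume "z \<in> D x"
        then consider "(z, x) \<in> L" | y where "z = y ^ p" "(idx (y ^ p), idx x) \<in> R\<^sup>="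
          unfolding D_def by blast
        then show "z \<in> span (frobenius_orbits C)"
        proof cases
          case (2 y)
          have "y \<in> span (frobenius_orbits C)"
          proof (cases "y \<in> range emb")
            case True
            then obtain c where "y = emb c * 1" by auto
            moreover have "1 \<in> frobenius_orbits C" by (simp add: frobenius_orbits_def)
            ultimately show ?thesis by (metis span_base span_scale)
          next
            case False
            \<comment> \<open>The index of \<open>y\<close> is strictly below that of
              \<open>y ^ p\<close>, hence below that of \<open>x\<close>, so the induction
              hypothesis applies to \<open>y\<close>.\<close>
            then have "(idx y, idx x) \<in> R" using power[OF False] 2(2) trans by (auto dest: transD)
            then show ?thesis using 1 by (simp add: L_iff)
          qed
          then show ?thesis unfolding 2 using frob_span frobenius_orbits_power by blast
        qed (use 1 in blast)
      qed
      then show ?thesis using False unfolding C_def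
        by (metis (mono_tags, lifting) mem_Collect_eq span_minimal subspace_span subsetD)
    qed
  qed
  have C_indep: "\<forall>c\<in>T. u c = 0" if T: "finite T" "T \<subseteq> C" "(\<Sum>c\<in>T. emb (u c) * c) = y ^ p" for T u y
  proof (rule ccontr)
    assume "\<not> (\<forall>c\<in>T. u c = 0)"
    define S where "S = {c\<in>T. u c \<noteq> 0}"
    have S: "finite S" "S \<noteq> {}" "S \<subseteq> C" using T \<open>\<not> _\<close> by (auto simp: S_def)
    have sum_S: "(\<Sum>c\<in>S. emb (u c) * c) = y ^ p"
      unfolding S_def T(3)[symmetric] using T(1) by (intro sum.mono_neutral_left) auto
    \<comment> \<open>The converse of \<open>L\<close> is acyclic, hence well-founded on the finite
      set \<open>S\<close>; a minimal element for it is the \<open>L\<close>-largest element of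
      \<open>S\<close>.\<close>
    have "wf (Restr (L\<inverse>) S)"
      using S(1) wf_L by (intro finite_acyclic_wf) 
       (auto intro: acyclic_subset[OF acyclic_converse[THEN iffD2, OF wf_acyclic[OF wf_L]]])
    then obtain x where x: "x \<in> S" and top: "\<And>c. (c, x) \<in> Restr (L\<inverse>) S \<Longrightarrow> c \<notin> S"
      using S(2) by (meson wf_eq_minimal ex_in_conv)
    then have max: "(c, x) \<in> L" if "c \<in> S - {x}" for c
      using total_L[of c x] top[of c] x that by blast
    have "emb (u x) * x = y ^ p - (\<Sum>c\<in>S - {x}. emb (u c) * c)"
      using sum.remove[OF S(1) x, of "\<lambda>c. emb (u c) * c"] sum_S by (simp add: algebra_simps)
    \<comment> \<open>Every summand has index at most that of the largest element \<open>x\<close>,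
      so by ultrametricity their sum \<open>y ^ p\<close> does too.\<close>
    moreover have "y ^ p \<in> span (D x)"
    proof -
      have idx_0: "(idx 0, i) \<in> R\<^sup>=" if "(idx x, i) \<in> R\<^sup>=" for x i
        using scale[of 0 x] that trans by (auto dest: transD)
      have "(idx (\<Sum>c\<in>S'. emb (u c) * c), idx x) \<in> R\<^sup>=" if "S' \<subseteq> S" for S'
        using finite_subset[OF that S(1)] that
      proof (induction S' rule: finite_induct)
        case (insert c F)
        have "(idx c, idx x) \<in> R\<^sup>=" using insert.prems L_imp_R[OF max] by (cases "c = x") auto
        then have "(idx (emb (u c) * c), idx x) \<in> R\<^sup>="
          using scale[of "u c" c] trans by (auto dest: transD)
        then show ?case using insert ultra by simp
      qed (use idx_0[of x] in simp)
      then have "(idx (y ^ p), idx x) \<in> R\<^sup>=" using sum_S by force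
      then show ?thesis unfolding D_def by (intro span_base) blast
    qed
    moreover have "(\<Sum>c\<in>S - {x}. emb (u c) * c) \<in> span (D x)"
      using max unfolding D_def by (intro span_sum span_scale span_base) blast
    ultimately have *: "emb (u x) * x \<in> span (D x)" by (simp only: span_diff)
    have "emb (u x) \<noteq> 0" using x by (simp add: S_def)
    then have eq: "emb (inverse (u x)) * (emb (u x) * x) = x"
      by (simp add: emb_inverse)
    have "x \<in> span (D x)" using span_scale[OF *, of "inverse (u x)"] by (simp only: eq)
    then show False using x S(3) by (auto simp: C_def)
  qed
  have "independent (frobenius_orbits C)"
    by (rule independent_orbits) (rule C_indep)
  then have "is_basis (frobenius_orbits C)"
    using spanning by (auto simp: is_basis_def)
  then show ?thesis using frobenius_closed_orbits by (intro exI conjI)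
qed

end

section \<open>Pole orders in a finite extension of a discretely valued field\<close>

definition discrete_valuation :: "('g::field \<Rightarrow> int) \<Rightarrow> bool"
  where "discrete_valuation v \<longleftrightarrow>
    (\<forall>a b. a \<noteq> 0 \<longrightarrow> b \<noteq> 0 \<longrightarrow> v (a * b) = v a + v b) \<and>
    (\<forall>a b. a \<noteq> 0 \<longrightarrow> b \<noteq> 0 \<longrightarrow> a + b \<noteq> 0 \<longrightarrow> min (v a) (v b) \<le> v (a + b)) \<and>
    (\<exists>a. a \<noteq> 0 \<and> v a = 1)"

text \<open>The value of \<open>v\<close> at \<open>0\<close> is junk; here \<open>0\<close> counts as having valuation \<open>\<infinity>\<close>.\<close>

definition val_ge :: "('g::field \<Rightarrow> int) \<Rightarrow> int \<Rightarrow> 'g set"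
  where "val_ge v c = {a. a = 0 \<or> c \<le> v a}"

definition uniformizer :: "('g::field \<Rightarrow> int) \<Rightarrow> 'g"
  where "uniformizer v = (SOME a. a \<noteq> 0 \<and> v a = 1)"

locale valued_field =
  fixes v :: "'g::field \<Rightarrow> int"
  assumes discrete_valuation: "discrete_valuation v"
begin

lemma val_mult: "a \<noteq> 0 \<Longrightarrow> b \<noteq> 0 \<Longrightarrow> v (a * b) = v a + v b"
  and val_add: "a \<noteq> 0 \<Longrightarrow> b \<noteq> 0 \<Longrightarrow> a + b \<noteq> 0 \<Longrightarrow> min (v a) (v b) \<le> v (a + b)"
  using discrete_valuation unfolding discrete_valuation_def by blast+

lemma uniformizer: "uniformizer v \<noteq> 0" "v (uniformizer v) = 1"
proof -
  have "\<exists>a. a \<noteq> 0 \<and> v a = 1"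
    using discrete_valuation unfolding discrete_valuation_def by blast
  from someI_ex[OF this] show "uniformizer v \<noteq> 0" "v (uniformizer v) = 1"
    by (simp_all add: uniformizer_def)
qed

lemma val_1: "v 1 = 0"
  using val_mult[of 1 1] by simp

lemma val_power: "a \<noteq> 0 \<Longrightarrow> v (a ^ n) = int n * v a"
  by (induction n) (simp_all add: val_1 val_mult algebra_simps)

lemma val_inverse: "a \<noteq> 0 \<Longrightarrow> v (inverse a) = - v a"
  using val_mult[of a "inverse a"] by (simp add: val_1)

lemma val_divide: "a \<noteq> 0 \<Longrightarrow> b \<noteq> 0 \<Longrightarrow> v (a / b) = v a - v b"
  by (simp add: divide_inverse val_mult val_inverse)

lemma val_ge_0 [simp]: "0 \<in> val_ge v c"
  and val_ge_1: "1 \<in> val_ge v 0"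
  by (simp_all add: val_ge_def val_1)

lemma val_ge_mono: "a \<in> val_ge v c \<Longrightarrow> d \<le> c \<Longrightarrow> a \<in> val_ge v d"
  by (auto simp: val_ge_def)

lemma val_ge_add: "a \<in> val_ge v c \<Longrightarrow> b \<in> val_ge v c \<Longrightarrow> a + b \<in> val_ge v c"
  using val_add[of a b] by (cases "a = 0 \<or> b = 0 \<or> a + b = 0") (auto simp: val_ge_def)

lemma val_ge_mult: "a \<in> val_ge v c \<Longrightarrow> b \<in> val_ge v d \<Longrightarrow> a * b \<in> val_ge v (c + d)"
  by (cases "a = 0 \<or> b = 0") (auto simp: val_ge_def val_mult)

lemma val_ge_power: "a \<in> val_ge v c \<Longrightarrow> a ^ n \<in> val_ge v (int n * c)"
  by (cases "n = 0"; cases "a = 0")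
    (auto simp: val_ge_def val_power val_1 mult_left_mono power_0_left)

end

text \<open>A dimension count for the set of powers. Coefficients are attached to exponents, which
  makes the relation a polynomial in \<open>x\<close>; if two exponents give the same power, that
  coincidence is itself the relation.\<close>

lemma (in field_extension) powers_dependent:
  assumes W: "finite W" "\<And>i. i \<in> I \<Longrightarrow> x ^ i \<in> span W" and I: "finite I" "card W < card I"
  obtains g where "\<exists>i\<in>I. g i \<noteq> 0" "(\<Sum>i\<in>I. emb (g i) * x ^ i) = 0"
proof (cases "inj_on (\<lambda>i. x ^ i) I")
  case True
  have "dependent ((\<lambda>i. x ^ i) ` I)"
  proof (rule ccontr)
    assume "\<not> dependent ((\<lambda>i. x ^ i) ` I)"
    then have "card ((\<lambda>i. x ^ i) ` I) \<le> card W"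
      using independent_span_bound[OF W(1)] W(2) by blast
    then show False using I(2) unfolding card_image[OF True] by simp
  qed
  then obtain u where "\<exists>y\<in>(\<lambda>i. x ^ i) ` I. u y \<noteq> 0" "(\<Sum>y\<in>(\<lambda>i. x ^ i) ` I. emb (u y) * y) = 0"
    unfolding dependent_finite[OF finite_imageI[OF I(1)]] by blast
  then have "\<exists>i\<in>I. u (x ^ i) \<noteq> 0" "(\<Sum>i\<in>I. emb (u (x ^ i)) * x ^ i) = 0"
    by (blast, simp only: sum.reindex[OF True] o_def)
  then show thesis by (rule that)
next
  case False
  then obtain i j where ij: "i \<in> I" "j \<in> I" "i \<noteq> j" "x ^ i = x ^ j"
    unfolding inj_on_def by blast
  define g :: "nat \<Rightarrow> 'k" where "g k = (if k = i then 1 else if k = j then - 1 else 0)" for k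
  have "(\<Sum>k\<in>I. emb (g k) * x ^ k) = (\<Sum>k\<in>{i, j}. emb (g k) * x ^ k)"
    using ij I(1) by (intro sum.mono_neutral_right) (auto simp: g_def)
  also have "\<dots> = 0" using ij by (simp add: g_def emb_minus emb_one)
  finally have "(\<Sum>k\<in>I. emb (g k) * x ^ k) = 0" .
  moreover have "g i \<noteq> 0" by (simp add: g_def)
  ultimately show thesis using that[of g] ij(1) by blast
qed

locale finite_extension = field_extension tau
  for tau :: "'g::field \<Rightarrow> 'f::field" +
  fixes E :: "'f set"
  assumes finite_E: "finite E" and independent_E: "independent E" and span_E: "span E = UNIV"
begin

text \<open>The free module with basis \<open>E\<close> over the valuation ring of \<open>v\<close>,
  scaled so that coordinates may have poles of order up to \<open>c\<close>.\<close>

definition lattice :: "('g \<Rightarrow> int) \<Rightarrow> int \<Rightarrow> 'f set"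
  where "lattice v c = {x. \<forall>e\<in>E. representation E x e \<in> val_ge v (- c)}"

text \<open>The integral closure in the extension of the valuation ring of \<open>v\<close>, described as the
  ring of almost integral elements.\<close>

definition integers :: "('g \<Rightarrow> int) \<Rightarrow> 'f set"
  where "integers v = {y. \<exists>c. \<forall>j. y ^ j \<in> lattice v c}"

text \<open>If \<open>w\<close> is the largest pole order of \<open>x\<close> at the extensions of \<open>v\<close>, with the uniformizer
  of \<open>v\<close> having order \<open>1\<close>, then this is \<open>(card E + 1) w\<close> rounded up.
  The factor exceeds every ramification index, so the value \<open>1\<close> does not occur.\<close>

definition pole_order :: "('g \<Rightarrow> int) \<Rightarrow> 'f \<Rightarrow> nat"
  where "pole_order v x =
    (LEAST k. tau (uniformizer v) ^ k * x ^ Suc (card E) \<in> integers v)"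

lemma representation_plus: "representation E (x + y) e = representation E x e + representation E y e"
  using representation_add[OF independent_E] by (simp add: span_E)

lemma representation_times: "representation E (tau a * x) e = a * representation E x e"
  using representation_scale[OF independent_E] by (simp add: span_E)

lemma representation_expand: "(\<Sum>e\<in>E. tau (representation E x e) * e) = x"
  using sum_representation_eq[OF independent_E _ finite_E] by (simp add: span_E)

end

locale valued_extension = finite_extension tau E + valued_field v
  for tau :: "'g::field \<Rightarrow> 'f::field" and E and v :: "'g \<Rightarrow> int"
begin

section \<open>Lattices over the valuation ring\<close>

lemma lattice_0 [simp]: "0 \<in> lattice v c"
  using representation_times[of 0 0] by (simp add: lattice_def)

lemma lattice_mono: "x \<in> lattice v c \<Longrightarrow> c \<le> d \<Longrightarrow> x \<in> lattice v d"
  by (auto simp: lattice_def intro: val_ge_mono)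

lemma lattice_add: "x \<in> lattice v c \<Longrightarrow> y \<in> lattice v c \<Longrightarrow> x + y \<in> lattice v c"
  by (auto simp: lattice_def representation_plus intro: val_ge_add)

lemma lattice_sum: "(\<And>i. i \<in> I \<Longrightarrow> f i \<in> lattice v c) \<Longrightarrow> sum f I \<in> lattice v c"
  by (induction I rule: infinite_finite_induct) (auto intro: lattice_add)

lemma lattice_of_nat: "x \<in> lattice v c \<Longrightarrow> of_nat k * x \<in> lattice v c"
  by (induction k) (auto simp: algebra_simps intro: lattice_add)

lemma lattice_scale: "a \<in> val_ge v d \<Longrightarrow> x \<in> lattice v c \<Longrightarrow> tau a * x \<in> lattice v (c - d)"
  using val_ge_mult[of a d _ "- c"] by (simp add: lattice_def representation_times)

lemma lattice_scale_0: "a \<in> val_ge v 0 \<Longrightarrow> x \<in> lattice v c \<Longrightarrow> tau a * x \<in> lattice v c"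
  using lattice_scale[of a 0] by simp

lemma lattice_minus: "x \<in> lattice v c \<Longrightarrow> - x \<in> lattice v c"
proof -
  have "v (- 1) + v (- 1) = 0" using val_mult[of "- 1" "- 1"] by (simp add: val_1)
  then have "- 1 \<in> val_ge v 0" by (simp add: val_ge_def)
  then show "x \<in> lattice v c \<Longrightarrow> - x \<in> lattice v c"
    using lattice_scale_0[of "- 1" x] by (simp add: emb_minus emb_one)
qed

lemma lattice_exists: "\<exists>c\<ge>0. x \<in> lattice v c"
proof -
  let ?c = "\<Sum>e\<in>E. \<bar>v (representation E x e)\<bar>"
  have "- ?c \<le> v (representation E x e)" if "e \<in> E" for e
    using member_le_sum[OF that, of "\<lambda>e. \<bar>v (representation E x e)\<bar>"] finite_E by simp
  then have "x \<in> lattice v ?c" by (simp add: lattice_def val_ge_def)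
  then show ?thesis by (intro exI[of _ ?c]) (simp add: sum_nonneg)
qed

lemma lattice_exists_finite: "finite A \<Longrightarrow> \<exists>c\<ge>0. A \<subseteq> lattice v c"
proof (induction A rule: finite_induct)
  case (insert x A)
  obtain c d where "c \<ge> 0" "A \<subseteq> lattice v c" "d \<ge> 0" "x \<in> lattice v d"
    using insert.IH lattice_exists by blast
  then show ?case by (intro exI[of _ "max c d"]) (auto intro: lattice_mono)
qed auto

text \<open>The constant \<open>c0\<close> bounds the poles of the coordinates of the finitely many
  products of basis elements, so a single loss term serves all \<open>x\<close> and
  \<open>y\<close>.\<close>

lemma lattice_mult:
  "\<exists>c0\<ge>0. \<forall>c d x y. x \<in> lattice v c \<longrightarrow> y \<in> lattice v d \<longrightarrow> x * y \<in> lattice v (c + d + c0)"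
proof -
  obtain c0 where c0: "c0 \<ge> 0" "(\<lambda>(e, f). e * f) ` (E \<times> E) \<subseteq> lattice v c0"
    using lattice_exists_finite[of "(\<lambda>(e, f). e * f) ` (E \<times> E)"] finite_E by auto
  have "x * y \<in> lattice v (c + d + c0)" if xy: "x \<in> lattice v c" "y \<in> lattice v d" for c d x y
  proof -
    have "tau (representation E x e * representation E y f) * (e * f) \<in> lattice v (c + d + c0)"
      if "e \<in> E" "f \<in> E" for e f
    proof -
      have "representation E x e * representation E y f \<in> val_ge v (- c + - d)"
        using xy that by (intro val_ge_mult) (auto simp: lattice_def)
      moreover have "e * f \<in> lattice v c0" using c0 that by auto
      ultimately have "tau (representation E x e * representation E y f) * (e * f) \<in> lattice v (c0 - (- c + - d))"
        by (rule lattice_scale)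
      then show ?thesis by (simp add: algebra_simps)
    qed
    then have "(\<Sum>e\<in>E. \<Sum>f\<in>E. tau (representation E x e * representation E y f) * (e * f))
        \<in> lattice v (c + d + c0)"
      by (intro lattice_sum)
    also have "(\<Sum>e\<in>E. \<Sum>f\<in>E. tau (representation E x e * representation E y f) * (e * f)) =
        (\<Sum>e\<in>E. tau (representation E x e) * e) * (\<Sum>f\<in>E. tau (representation E y f) * f)"
      by (simp add: sum_product emb_mult algebra_simps)
    finally show ?thesis by (simp add: representation_expand)
  qed
  then show ?thesis using c0(1) by blast
qed

section \<open>The ring of integral elements\<close>

lemma integersI: "(\<And>j. y ^ j \<in> lattice v c) \<Longrightarrow> y \<in> integers v"
  unfolding integers_def by blast

lemma integersE:
  assumes "y \<in> integers v"
  obtains c where "\<And>j. y ^ j \<in> lattice v c"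
  using assms unfolding integers_def by blast

lemma integers_mult:
  assumes "x \<in> integers v" "y \<in> integers v"
  shows "x * y \<in> integers v"
proof -
  obtain c d where "\<And>j. x ^ j \<in> lattice v c" "\<And>j. y ^ j \<in> lattice v d"
    using assms by (metis integersE)
  moreover obtain c0 where "\<And>c d x y. x \<in> lattice v c \<Longrightarrow> y \<in> lattice v d \<Longrightarrow> x * y \<in> lattice v (c + d + c0)"
    using lattice_mult by blast
  ultimately show ?thesis by (intro integersI[of _ "c + d + c0"]) (simp add: power_mult_distrib)
qed

text \<open>All mixed products in the binomial expansion of a power lie in one lattice, because the
  bounds for the powers of \<open>x\<close> and of \<open>y\<close> are independent of the
  exponents.\<close>

lemma integers_add:
  assumes "x \<in> integers v" "y \<in> integers v"
  shows "x + y \<in> integers v"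
proof -
  obtain c d where cd: "\<And>j. x ^ j \<in> lattice v c" "\<And>j. y ^ j \<in> lattice v d"
    using assms by (metis integersE)
  obtain c0 where c0: "\<And>c d x y. x \<in> lattice v c \<Longrightarrow> y \<in> lattice v d \<Longrightarrow> x * y \<in> lattice v (c + d + c0)"
    using lattice_mult by blast
  have "(x + y) ^ j \<in> lattice v (c + d + c0)" for j
    unfolding binomial_ring mult.assoc by (intro lattice_sum lattice_of_nat c0 cd)
  then show ?thesis by (rule integersI)
qed

lemma integers_tau:
  assumes "a \<in> val_ge v 0"
  shows "tau a \<in> integers v"
proof -
  obtain c where "1 \<in> lattice v c" using lattice_exists by blast
  then have "tau (a ^ j) * 1 \<in> lattice v c" for j
    using val_ge_power[OF assms, of j] by (intro lattice_scale_0) auto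
  then show ?thesis by (intro integersI[of _ c]) (simp add: emb_power)
qed

lemma integers_0: "0 \<in> integers v" and integers_1: "1 \<in> integers v"
  using integers_tau[of 0] integers_tau[of 1] val_ge_1 by (simp_all add: emb_one)

lemma integers_scale: "a \<in> val_ge v 0 \<Longrightarrow> x \<in> integers v \<Longrightarrow> tau a * x \<in> integers v"
  by (intro integers_mult integers_tau)

lemma integers_power: "x \<in> integers v \<Longrightarrow> x ^ n \<in> integers v"
  by (induction n) (auto intro: integers_mult integers_1)

lemma integers_sum: "(\<And>i. i \<in> I \<Longrightarrow> f i \<in> integers v) \<Longrightarrow> sum f I \<in> integers v"
  by (induction I rule: infinite_finite_induct) (auto intro: integers_add integers_0)

lemma integers_of_nat: "x \<in> integers v \<Longrightarrow> of_nat k * x \<in> integers v"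
  by (induction k) (auto simp: algebra_simps intro: integers_add integers_0)

lemma integers_minus: "x \<in> integers v \<Longrightarrow> - x \<in> integers v"
proof -
  have "tau (- 1) \<in> integers v"
  proof -
    obtain c where "1 \<in> lattice v c" using lattice_exists by blast
    then have "tau (- 1) ^ j \<in> lattice v c" for j
      using lattice_minus by (cases "even j") (auto simp: emb_minus emb_one)
    then show ?thesis by (rule integersI)
  qed
  then show "x \<in> integers v \<Longrightarrow> - x \<in> integers v"
    using integers_mult[of "tau (- 1)" x] by (simp add: emb_minus emb_one)
qed

text \<open>Dividing the exponent by \<open>n\<close> with remainder writes each power of
  \<open>x\<close> as a power of \<open>x ^ n\<close> times one of finitely many elements.\<close>

lemma integers_root:
  assumes "n > 0" "x ^ n \<in> integers v"
  shows "x \<in> integers v"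
proof -
  obtain c where c: "\<And>j. (x ^ n) ^ j \<in> lattice v c"
    using assms(2) by (metis integersE)
  obtain d where "(\<lambda>i. x ^ i) ` {..<n} \<subseteq> lattice v d"
    using lattice_exists_finite[of "(\<lambda>i. x ^ i) ` {..<n}"] by auto
  then have d: "x ^ i \<in> lattice v d" if "i < n" for i
    using that by auto
  obtain c0 where c0: "\<And>c d x y. x \<in> lattice v c \<Longrightarrow> y \<in> lattice v d \<Longrightarrow> x * y \<in> lattice v (c + d + c0)"
    using lattice_mult by blast
  have "(x ^ n) ^ (j div n) * x ^ (j mod n) \<in> lattice v (c + d + c0)" for j
    using assms(1) by (intro c0 c d) simp
  moreover have "(x ^ n) ^ (j div n) * x ^ (j mod n) = x ^ j" for j
    by (simp flip: power_mult power_add)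
  ultimately show ?thesis by (intro integersI[of _ "c + d + c0"]) simp
qed

text \<open>The coefficients \<open>g i\<close> of this monic equation lie in the valuation ring,
  while \<open>z\<close> is only integral in the extension. Repeated substitution reduces every
  power of \<open>x\<close> to products of powers of \<open>z\<close> with powers of
  \<open>x\<close> below \<open>m\<close>, and these are bounded.\<close>

lemma integers_if_monic:
  assumes m: "m > 0" and z: "z \<in> integers v" and g: "\<And>i. g i \<in> val_ge v 0"
    and eq: "x ^ m = z - (\<Sum>i<m. tau (g i) * x ^ i)"
  shows "x \<in> integers v"
proof -
  obtain c where c: "\<And>j. z ^ j \<in> lattice v c"
    using z by (metis integersE)
  obtain d where "(\<lambda>i. x ^ i) ` {..<m} \<subseteq> lattice v d"
    using lattice_exists_finite[of "(\<lambda>i. x ^ i) ` {..<m}"] by auto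
  then have d: "x ^ i \<in> lattice v d" if "i < m" for i
    using that by auto
  obtain c0 where c0: "\<And>c d x y. x \<in> lattice v c \<Longrightarrow> y \<in> lattice v d \<Longrightarrow> x * y \<in> lattice v (c + d + c0)"
    using lattice_mult by blast
  \<comment> \<open>The factor \<open>z ^ k\<close> belongs to the claim because each substitution
    for \<open>x ^ m\<close> creates another factor \<open>z\<close>.\<close>
  have "z ^ k * x ^ n \<in> lattice v (c + d + c0)" for k n
  proof (induction n arbitrary: k rule: less_induct)
    case (less n)
    show ?case
    proof (cases "n < m")
      case True
      then show ?thesis by (intro c0 c d)
    next
      case False
      then have "z ^ k * x ^ n = z ^ k * (x ^ (n - m) * x ^ m)"
        by (simp flip: power_add)
      also have "\<dots> = z ^ Suc k * x ^ (n - m) - (\<Sum>i<m. tau (g i) * (z ^ k * (x ^ (n - m) * x ^ i)))"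
        unfolding eq by (simp add: algebra_simps sum_distrib_left)
      also have "\<dots> = z ^ Suc k * x ^ (n - m) + - (\<Sum>i<m. tau (g i) * (z ^ k * x ^ (n - m + i)))"
        by (simp flip: power_add)
      also have "\<dots> \<in> lattice v (c + d + c0)"
        using False m g by (intro lattice_add lattice_minus lattice_sum lattice_scale_0 less) auto
      finally show ?thesis .
    qed
  qed
  from this[of 0] show ?thesis by (intro integersI[of _ "c + d + c0"]) simp
qed

text \<open>Multiplication by \<open>x\<close> has an integral matrix in the basis \<open>E\<close>,
  so it preserves the lattice, which contains \<open>1\<close>.\<close>

lemma powers_in_lattice:
  assumes x: "\<And>e. e \<in> E \<Longrightarrow> x * e \<in> lattice v 0" and 1: "1 \<in> lattice v 0"
  shows "x ^ j \<in> lattice v 0"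
proof (induction j)
  case (Suc j)
  have "(\<Sum>e\<in>E. tau (representation E (x ^ j) e) * (x * e)) \<in> lattice v 0"
    using Suc x by (intro lattice_sum lattice_scale_0) (auto simp: lattice_def)
  also have "(\<Sum>e\<in>E. tau (representation E (x ^ j) e) * (x * e)) =
      x * (\<Sum>e\<in>E. tau (representation E (x ^ j) e) * e)"
    by (simp add: sum_distrib_left algebra_simps)
  finally show ?case by (simp add: representation_expand)
qed (simp add: 1)

section \<open>The pole order\<close>

abbreviation "t \<equiv> tau (uniformizer v)"

lemma t_integer: "t \<in> integers v"
  using uniformizer by (intro integers_tau) (simp add: val_ge_def)

text \<open>The pole bound for \<open>y ^ j\<close> grows at most linearly in \<open>j\<close>, with
  slope \<open>c + c0\<close>; taking \<open>k\<close> equal to this slope cancels the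
  growth.\<close>

lemma integers_exists: "\<exists>k. t ^ k * y \<in> integers v"
proof -
  obtain c where c: "c \<ge> 0" "y \<in> lattice v c" using lattice_exists by blast
  obtain c1 where c1: "1 \<in> lattice v c1" using lattice_exists by blast
  obtain c0 where c0: "c0 \<ge> 0" "\<And>c d x y. x \<in> lattice v c \<Longrightarrow> y \<in> lattice v d \<Longrightarrow> x * y \<in> lattice v (c + d + c0)"
    using lattice_mult by blast
  have y: "y ^ j \<in> lattice v (int j * (c + c0) + c1)" for j
  proof (induction j)
    case (Suc j)
    then have "y * y ^ j \<in> lattice v (c + (int j * (c + c0) + c1) + c0)"
      by (intro c0 c)
    then show ?case by (simp add: algebra_simps)
  qed (simp add: c1)
  define k where "k = nat (c + c0)"
  have k: "int k = c + c0" using c c0 by (simp add: k_def)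
  have "(t ^ k * y) ^ j \<in> lattice v c1" for j
  proof -
    have "uniformizer v ^ (k * j) \<in> val_ge v (int (k * j))"
      using uniformizer by (simp add: val_ge_def val_power)
    then have "tau (uniformizer v ^ (k * j)) * y ^ j \<in> lattice v (int j * (c + c0) + c1 - int (k * j))"
      using y by (rule lattice_scale)
    also have "int j * (c + c0) + c1 - int (k * j) = c1" by (simp add: k algebra_simps)
    finally show ?thesis by (simp add: emb_power power_mult_distrib power_mult)
  qed
  then show ?thesis by (intro exI[of _ k] integersI)
qed

abbreviation "q \<equiv> Suc (card E)"

lemma pole_order_le_iff: "pole_order v x \<le> k \<longleftrightarrow> t ^ k * x ^ q \<in> integers v"
proof
  assume le: "pole_order v x \<le> k"
  have "t ^ pole_order v x * x ^ q \<in> integers v"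
    unfolding pole_order_def by (rule LeastI_ex) (rule integers_exists)
  then have "t ^ (k - pole_order v x) * t ^ pole_order v x * x ^ q \<in> integers v"
    by (simp only: mult.assoc integers_mult integers_power t_integer)
  then show "t ^ k * x ^ q \<in> integers v"
    using le by (simp only: power_add[symmetric] le_add_diff_inverse2)
next
  assume "t ^ k * x ^ q \<in> integers v"
  then show "pole_order v x \<le> k" unfolding pole_order_def by (rule Least_le)
qed

lemma pole_order_eq_0_iff: "pole_order v x = 0 \<longleftrightarrow> x \<in> integers v"
  using pole_order_le_iff[of x 0] integers_root[of q x] integers_power[of x q] by auto

text \<open>Each mixed term \<open>t ^ k * (x ^ i * y ^ (q - i))\<close> is integral because its
  \<open>q\<close>-th power is the product of \<open>(t ^ k * x ^ q) ^ i\<close> and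
  \<open>(t ^ k * y ^ q) ^ (q - i)\<close>.\<close>

lemma pole_order_add:
  assumes "pole_order v x \<le> k" "pole_order v y \<le> k"
  shows "pole_order v (x + y) \<le> k"
proof -
  have "t ^ k * (x ^ i * y ^ (q - i)) \<in> integers v" if "i \<le> q" for i
  proof (rule integers_root)
    have "(t ^ k) ^ q = (t ^ k) ^ i * (t ^ k) ^ (q - i)"
      using that by (simp only: power_add[symmetric] le_add_diff_inverse)
    moreover have "(x ^ i) ^ q = (x ^ q) ^ i" "(y ^ (q - i)) ^ q = (y ^ q) ^ (q - i)"
      by (simp_all only: power_mult[symmetric] mult.commute)
    ultimately have "(t ^ k * (x ^ i * y ^ (q - i))) ^ q = (t ^ k * x ^ q) ^ i * (t ^ k * y ^ q) ^ (q - i)"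
      by (simp only: power_mult_distrib ac_simps)
    then show "(t ^ k * (x ^ i * y ^ (q - i))) ^ q \<in> integers v"
      using assms unfolding pole_order_le_iff by (simp only: integers_mult integers_power)
  qed simp
  then have "(\<Sum>i\<le>q. of_nat (q choose i) * (t ^ k * (x ^ i * y ^ (q - i)))) \<in> integers v"
    by (intro integers_sum integers_of_nat) simp
  also have "(\<Sum>i\<le>q. of_nat (q choose i) * (t ^ k * (x ^ i * y ^ (q - i)))) = t ^ k * (x + y) ^ q"
    unfolding binomial_ring sum_distrib_left by (intro sum.cong refl) (simp only: ac_simps)
  finally show ?thesis unfolding pole_order_le_iff .
qed

lemma pole_order_scale:
  assumes "a \<in> val_ge v 0"
  shows "pole_order v (tau a * x) \<le> pole_order v x"
proof -
  have "tau (a ^ q) * (t ^ pole_order v x * x ^ q) \<in> integers v"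
    using val_ge_power[OF assms, of q] pole_order_le_iff[of x "pole_order v x"]
    by (intro integers_scale) (simp_all del: power_Suc)
  then show ?thesis
    unfolding pole_order_le_iff by (simp only: emb_power power_mult_distrib ac_simps)
qed

text \<open>Normalize a linear relation between \<open>x, \<dots>, x\<^sup>q\<close> so that its coefficients are integral, and
  let \<open>m\<close> be the largest index of a unit coefficient. If the pole order is at most \<open>1\<close>, then the terms
  of index above \<open>m\<close> are integral, so the relation is an equation of integral dependence for \<open>x\<close>.\<close>

lemma pole_order_neq_1: "pole_order v x \<noteq> 1"
proof
  assume order_1: "pole_order v x = 1"
  then have t_xq: "t * x ^ q \<in> integers v"
    using pole_order_le_iff[of x 1] by (simp del: power_Suc)
  \<comment> \<open>There is one more power than the dimension. Leaving out the exponent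
    \<open>0\<close> ensures that the index \<open>m\<close> chosen below is positive.\<close>
  obtain g where g: "\<exists>i\<in>{1..q}. g i \<noteq> 0" "(\<Sum>i\<in>{1..q}. tau (g i) * x ^ i) = 0"
    by (rule powers_dependent[OF finite_E, where I = "{1..q}"]) (simp_all add: span_E)
  define I where "I = {i\<in>{1..q}. g i \<noteq> 0}"
  have I: "finite I" "I \<noteq> {}" using g(1) by (auto simp: I_def)
  define \<mu> where "\<mu> = Min ((\<lambda>i. v (g i)) ` I)"
  have \<mu>_le: "\<mu> \<le> v (g i)" if "i \<in> I" for i
    using I that by (simp add: \<mu>_def)
  define J where "J = {i\<in>I. v (g i) = \<mu>}"
  have "\<mu> \<in> (\<lambda>i. v (g i)) ` I" unfolding \<mu>_def using I by (intro Min_in) auto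
  then have J: "finite J" "J \<noteq> {}" using I by (auto simp: J_def)
  define m where "m = Max J"
  have m: "m \<in> J" unfolding m_def using J by (rule Max_in)
  have m_max: "i \<le> m" if "i \<in> J" for i using J that by (simp add: m_def)
  have mq: "1 \<le> m" "m \<le> q" "g m \<noteq> 0" "v (g m) = \<mu>"
    using m by (auto simp: J_def I_def)
  define h where "h i = (if i \<in> I then g i / g m else 0)" for i
  have h_0: "h i \<in> val_ge v 0" for i
    using \<mu>_le[of i] mq by (auto simp: h_def I_def val_ge_def val_divide)
  have h_1: "h i \<in> val_ge v 1" if "i > m" for i
  proof -
    have "v (g i) \<noteq> \<mu>" if "i \<in> I" using m_max[of i] \<open>i > m\<close> that by (auto simp: J_def)
    then show ?thesis
      using \<mu>_le[of i] mq by (auto simp: h_def I_def val_ge_def val_divide)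
  qed
  have h_m: "h m = 1" using m mq by (auto simp: h_def J_def)
  have "(\<Sum>i\<in>{1..q}. tau (h i) * x ^ i) = tau (inverse (g m)) * (\<Sum>i\<in>{1..q}. tau (g i) * x ^ i)"
    unfolding sum_distrib_left
    by (intro sum.cong) (auto simp: h_def I_def divide_inverse emb_mult)
  then have "(\<Sum>i\<in>{1..q}. tau (h i) * x ^ i) = 0" using g(2) by simp
  moreover have "(\<Sum>i\<in>{..q}. tau (h i) * x ^ i) = (\<Sum>i\<in>{1..q}. tau (h i) * x ^ i)"
    by (intro sum.mono_neutral_right) (auto simp: h_def I_def)
  moreover have "{..q} = {..<m} \<union> {m} \<union> {m<..q}" using mq by auto
  then have "(\<Sum>i\<in>{..q}. tau (h i) * x ^ i) =
      (\<Sum>i<m. tau (h i) * x ^ i) + tau (h m) * x ^ m + (\<Sum>i\<in>{m<..q}. tau (h i) * x ^ i)"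
    by (simp add: sum.union_disjoint[of "{..<m}" "{m<..q}"] disjoint_iff algebra_simps)
  ultimately have "(\<Sum>i<m. tau (h i) * x ^ i) + x ^ m + (\<Sum>i\<in>{m<..q}. tau (h i) * x ^ i) = 0"
    by (simp only: h_m emb_one mult_1_left)
  then have eq: "x ^ m = - (\<Sum>i\<in>{m<..q}. tau (h i) * x ^ i) - (\<Sum>i<m. tau (h i) * x ^ i)"
    by (simp only: eq_diff_eq eq_neg_iff_add_eq_0 ac_simps)
  \<comment> \<open>The \<open>q\<close>-th power is \<open>(t * x ^ q) ^ i\<close> times a
    coefficient of valuation at least \<open>q - i\<close>, since \<open>h i\<close> has valuation
    at least \<open>1\<close>; and \<open>i \<le> q\<close>.\<close>
  have "tau (h i) * x ^ i \<in> integers v" if i: "i \<in> {m<..q}" for i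
  proof (rule integers_root)
    have "h i ^ q * inverse (uniformizer v) ^ i \<in> val_ge v (int q * 1 + int i * (- 1))"
      using i by (intro val_ge_mult val_ge_power h_1) (auto simp: val_ge_def val_inverse uniformizer)
    then have "h i ^ q * inverse (uniformizer v) ^ i \<in> val_ge v 0"
      by (rule val_ge_mono) (use i in auto)
    then have "tau (h i ^ q * inverse (uniformizer v) ^ i) * (t * x ^ q) ^ i \<in> integers v"
      by (intro integers_scale integers_power t_xq)
    moreover have "tau (inverse (uniformizer v) ^ i) * t ^ i = 1"
      using uniformizer by (simp add: emb_power emb_inverse flip: power_mult_distrib)
    then have "tau (h i ^ q * inverse (uniformizer v) ^ i) * (t * x ^ q) ^ i = (tau (h i) * x ^ i) ^ q"
      unfolding power_mult_distrib emb_mult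
      by (simp add: emb_power algebra_simps del: power_Suc flip: power_mult)
    ultimately show "(tau (h i) * x ^ i) ^ q \<in> integers v" by simp
  qed simp
  then have "- (\<Sum>i\<in>{m<..q}. tau (h i) * x ^ i) \<in> integers v"
    by (intro integers_minus integers_sum)
  then have "x \<in> integers v"
    using mq h_0 eq by (intro integers_if_monic[of m _ h x]) auto
  then show False using order_1 pole_order_eq_0_iff[of x] by simp
qed

text \<open>Let \<open>k\<close> be the order of \<open>x\<close>. If that of \<open>x ^ p\<close>
  were at most \<open>k\<close>, the \<open>p\<close>-th power of \<open>t ^ (k - 1) * x ^ q\<close>
  would be integral, as \<open>k \<le> p * (k - 1)\<close>, and \<open>x\<close> would have order at
  most \<open>k - 1\<close>. The inequality rests on \<open>k \<ge> 2\<close>, that is, on the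
  missing value \<open>1\<close>.\<close>

lemma pole_order_power:
  assumes p: "p \<ge> 2" and x: "pole_order v x \<noteq> 0"
  shows "pole_order v x < pole_order v (x ^ p)"
proof (rule ccontr)
  define k where "k = pole_order v x"
  have k: "k \<ge> 2" using x pole_order_neq_1[of x] by (simp add: k_def)
  assume "\<not> pole_order v x < pole_order v (x ^ p)"
  then have "pole_order v (x ^ p) \<le> k" by (simp add: k_def)
  then have *: "t ^ k * (x ^ p) ^ q \<in> integers v" unfolding pole_order_le_iff .
  have le: "k \<le> p * (k - 1)"
  proof -
    have "k \<le> 2 * (k - 1)" using k by simp
    also have "\<dots> \<le> p * (k - 1)" using p by simp
    finally show ?thesis .
  qed
  have "t ^ (k - 1) * x ^ q \<in> integers v"
  proof (rule integers_root)
    have "(t ^ (k - 1) * x ^ q) ^ p = t ^ (p * (k - 1)) * (x ^ p) ^ q"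
      by (simp only: power_mult_distrib power_mult[symmetric] mult.commute)
    also have "t ^ (p * (k - 1)) = t ^ (p * (k - 1) - k) * t ^ k"
      using le by (simp only: power_add[symmetric] le_add_diff_inverse2)
    finally show "(t ^ (k - 1) * x ^ q) ^ p \<in> integers v"
      using * by (simp only: mult.assoc integers_mult integers_power t_integer)
  qed (use p in simp)
  then have "pole_order v x \<le> k - 1" unfolding pole_order_le_iff .
  then show False using k by (simp add: k_def)
qed

end

section \<open>Places of the rational function field\<close>

definition poly_ord :: "'k::field poly \<Rightarrow> 'k poly \<Rightarrow> nat"
  where "poly_ord f a = (GREATEST n. f ^ n dvd a)"

lemma irreducible_degree_pos: "irreducible f \<Longrightarrow> degree f > 0" for f :: "'k::field poly"
  using is_unit_iff_degree[of f] by (auto simp: irreducible_def)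

text \<open>The bound guarantees that the greatest exponent in \<open>poly_ord\<close> exists for
  \<open>a \<noteq> 0\<close>.\<close>

lemma power_dvd_bound:
  fixes f :: "'k::field poly"
  assumes "irreducible f" "a \<noteq> 0" "f ^ n dvd a"
  shows "n \<le> degree a"
proof -
  have "n \<le> n * degree f" using irreducible_degree_pos[OF assms(1)] by simp
  also have "\<dots> = degree (f ^ n)" using assms(1) by (subst degree_power_eq) auto
  also have "\<dots> \<le> degree a" using assms(2,3) by (intro dvd_imp_degree_le)
  finally show ?thesis .
qed

lemma poly_ord_ge:
  fixes f :: "'k::field poly"
  assumes "irreducible f" "a \<noteq> 0" "f ^ n dvd a"
  shows "n \<le> poly_ord f a"
  unfolding poly_ord_def
  using assms by (intro Greatest_le_nat[where b = "degree a"]) (auto intro: power_dvd_bound)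

lemma poly_ord_decompose:
  fixes f :: "'k::field poly"
  assumes "irreducible f" "a \<noteq> 0"
  obtains b where "a = f ^ poly_ord f a * b" "\<not> f dvd b"
proof -
  have "f ^ poly_ord f a dvd a"
    unfolding poly_ord_def
    by (rule GreatestI_nat[where k = 0 and b = "degree a"]) (use assms power_dvd_bound in auto)
  then obtain b where b: "a = f ^ poly_ord f a * b" by (elim dvdE)
  have "\<not> f dvd b"
  proof
    assume "f dvd b"
    then have "f ^ Suc (poly_ord f a) dvd a"
      by (subst b) (simp add: mult.commute mult_dvd_mono)
    then show False using poly_ord_ge[OF assms] by fastforce
  qed
  then show thesis using b that by blast
qed

lemma poly_ord_eqI:
  fixes f :: "'k::field poly"
  assumes "irreducible f" "a = f ^ n * b" "\<not> f dvd b"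
  shows "poly_ord f a = n"
  unfolding poly_ord_def
proof (rule Greatest_equality)
  show "f ^ n dvd a" by (simp add: assms)
  fix m assume m: "f ^ m dvd a"
  show "m \<le> n"
  proof (rule ccontr)
    assume "\<not> m \<le> n"
    then have "f ^ n * f ^ Suc (m - Suc n) dvd f ^ n * b"
      using m assms(2) by (simp del: power_Suc flip: power_add)
    then have "f ^ Suc (m - Suc n) dvd b" using assms(1) by (subst (asm) dvd_mult_cancel_left) auto
    then show False using assms(3) by (auto dest: dvd_mult_left)
  qed
qed

lemma poly_ord_eq_0: "irreducible f \<Longrightarrow> \<not> f dvd a \<Longrightarrow> poly_ord f a = 0" for f :: "'k::field poly"
  by (rule poly_ord_eqI[of f a 0 a]) simp_all

lemma poly_ord_1 [simp]: "irreducible f \<Longrightarrow> poly_ord f 1 = 0" for f :: "'k::field poly"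
  by (rule poly_ord_eq_0) (auto dest: irreducible_not_unit)

lemma poly_ord_mult:
  fixes f :: "'k::field poly"
  assumes "irreducible f" "a \<noteq> 0" "b \<noteq> 0"
  shows "poly_ord f (a * b) = poly_ord f a + poly_ord f b"
proof -
  obtain a' b' where a': "a = f ^ poly_ord f a * a'" "\<not> f dvd a'"
    and b': "b = f ^ poly_ord f b * b'" "\<not> f dvd b'"
    using poly_ord_decompose assms by metis
  have "\<not> f dvd a' * b'"
    using field_poly_irreducible_imp_prime[OF assms(1)] a' b' by (simp add: prime_elem_dvd_mult_iff)
  moreover have "a * b = f ^ (poly_ord f a + poly_ord f b) * (a' * b')"
    by (subst a'(1), subst b'(1)) (simp add: power_add)
  ultimately show ?thesis using assms(1) by (intro poly_ord_eqI)
qed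

lemma poly_ord_add:
  fixes f :: "'k::field poly"
  assumes "irreducible f" "a \<noteq> 0" "b \<noteq> 0" "a + b \<noteq> 0"
  shows "min (poly_ord f a) (poly_ord f b) \<le> poly_ord f (a + b)"
proof (rule poly_ord_ge)
  have "f ^ poly_ord f c dvd c" if "c \<noteq> 0" for c
    using poly_ord_decompose[OF assms(1) that] by (metis dvd_triv_left)
  then show "f ^ min (poly_ord f a) (poly_ord f b) dvd a + b"
    using assms by (intro dvd_add) (meson dvd_trans le_imp_power_dvd min.cobounded1 min.cobounded2)+
qed (use assms in auto)

lemma poly_ord_self: "irreducible f \<Longrightarrow> poly_ord f f = 1" for f :: "'k::field poly"
  by (rule poly_ord_eqI[of f f 1 1]) (auto dest: irreducible_not_unit)

lemma poly_ord_pos_iff: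
  fixes f :: "'k::field poly"
  assumes "irreducible f" "a \<noteq> 0"
  shows "poly_ord f a > 0 \<longleftrightarrow> f dvd a"
proof
  assume "poly_ord f a > 0"
  moreover obtain b where "a = f ^ poly_ord f a * b"
    using poly_ord_decompose[OF assms] .
  ultimately show "f dvd a" by (metis dvd_mult2 dvd_power)
qed (use poly_ord_ge[OF assms, of 1] in auto)

text \<open>A divisor of least positive degree does not split into two nonunits; scaling makes it
  monic.\<close>

lemma monic_irreducible_divisor:
  fixes a :: "'k::field poly"
  assumes "degree a > 0"
  obtains f where "irreducible f" "lead_coeff f = 1" "f dvd a"
proof -
  define h where "h = arg_min degree (\<lambda>h. h dvd a \<and> degree h > 0)"
  have h: "h dvd a" "degree h > 0" and min: "\<And>g. g dvd a \<Longrightarrow> degree g > 0 \<Longrightarrow> degree h \<le> degree g"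
    using arg_min_nat_lemma[of "\<lambda>h. h dvd a \<and> degree h > 0" a degree] assms
    by (auto simp: h_def)
  define f where "f = smult (inverse (lead_coeff h)) h"
  have h0: "h \<noteq> 0" using h by auto
  have f: "f dvd a" "degree f = degree h" "lead_coeff f = 1"
    using h h0 by (auto simp: f_def smult_dvd_iff)
  have "irreducible f"
  proof (rule irreducibleI)
    show "f \<noteq> 0" using f h by auto
    show "\<not> is_unit f" using f h \<open>f \<noteq> 0\<close> by (simp add: is_unit_iff_degree)
    fix x y assume xy: "f = x * y"
    show "is_unit x \<or> is_unit y"
    proof (rule ccontr)
      assume "\<not> (is_unit x \<or> is_unit y)"
      moreover have nz: "x \<noteq> 0" "y \<noteq> 0" using xy \<open>f \<noteq> 0\<close> by auto
      ultimately have "degree x > 0" "degree y > 0" by (auto simp: is_unit_iff_degree)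
      moreover have "degree f = degree x + degree y" using xy nz by (simp add: degree_mult_eq)
      moreover have "x dvd a" using f(1) xy by (metis dvd_mult_left)
      ultimately show False using min[of x] f(2) by simp
    qed
  qed
  then show thesis using f that by blast
qed

text \<open>Induction on the degree: after one factor \<open>h\<close> is split off, any other monic
  irreducible divisor divides the cofactor, since associated monic polynomials coincide.\<close>

lemma finite_monic_irreducible_divisors:
  fixes a :: "'k::field poly"
  assumes "a \<noteq> 0"
  shows "finite {f. irreducible f \<and> lead_coeff f = 1 \<and> f dvd a}"
  using assms
proof (induction "degree a" arbitrary: a rule: less_induct)
  case less
  show ?case
  proof (cases "degree a = 0")
    case True
    then have "is_unit a" using less.prems by (simp add: is_unit_iff_degree)
    then have "{f. irreducible f \<and> lead_coeff f = 1 \<and> f dvd a} = {}"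
      using dvd_unit_imp_unit irreducible_not_unit by blast
    then show ?thesis by (simp only: finite.emptyI)
  next
    case False
    then obtain h where h: "irreducible h" "lead_coeff h = 1" "h dvd a"
      using monic_irreducible_divisor by blast
    then obtain b where b: "a = h * b" by (elim dvdE)
    have "degree b < degree a"
      using b less.prems irreducible_degree_pos[OF h(1)] by (simp add: degree_mult_eq)
    then have fin: "finite {f. irreducible f \<and> lead_coeff f = 1 \<and> f dvd b}"
      using less b by auto
    have "f = h \<or> f dvd b" if f: "irreducible f" "lead_coeff f = 1" "f dvd a" for f
    proof (rule disjCI)
      assume "\<not> f dvd b"
      then have "f dvd h"
        using field_poly_irreducible_imp_prime[OF f(1)] f(3) b by (simp add: prime_elem_dvd_mult_iff)
      then obtain c where c: "h = f * c" by (elim dvdE)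
      then have "is_unit c" using h(1) f(1) irreducible_not_unit irreducibleD by metis
      then obtain u where u: "c = [:u:]" by (auto elim: is_unit_polyE)
      then have "h = smult u f" using c by simp
      then have "lead_coeff h = u * lead_coeff f" by simp
      then have "u = 1" using h(2) f(2) by (simp only: mult_1_right)
      then show "f = h" using \<open>h = smult u f\<close> by simp
    qed
    then have "{f. irreducible f \<and> lead_coeff f = 1 \<and> f dvd a} \<subseteq>
        insert h {f. irreducible f \<and> lead_coeff f = 1 \<and> f dvd b}" by blast
    then show ?thesis using fin by (meson finite_insert finite_subset)
  qed
qed

section \<open>Valuations on a fraction field\<close>

definition fract_val :: "('a::idom \<Rightarrow> int) \<Rightarrow> 'a fract \<Rightarrow> int"
  where "fract_val d g = (SOME n. \<exists>a b. a \<noteq> 0 \<and> b \<noteq> 0 \<and> g = Fract a b \<and> n = d a - d b)"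

text \<open>Cross-multiplication and additivity of \<open>d\<close> make the difference independent
  of the representation, so the choice in \<open>fract_val\<close> is forced.\<close>

lemma fract_val_Fract:
  assumes mult: "\<And>a b. a \<noteq> 0 \<Longrightarrow> b \<noteq> 0 \<Longrightarrow> d (a * b) = d a + d b" and "a \<noteq> 0" "b \<noteq> 0"
  shows "fract_val d (Fract a b) = d a - d b"
  unfolding fract_val_def
proof (rule some1_equality, rule ex1I)
  show *: "\<exists>a' b'. a' \<noteq> 0 \<and> b' \<noteq> 0 \<and> Fract a b = Fract a' b' \<and> d a - d b = d a' - d b'"
    using assms by blast
  then show "\<exists>a' b'. a' \<noteq> 0 \<and> b' \<noteq> 0 \<and> Fract a b = Fract a' b' \<and> d a - d b = d a' - d b'" .
  fix n assume "\<exists>a' b'. a' \<noteq> 0 \<and> b' \<noteq> 0 \<and> Fract a b = Fract a' b' \<and> n = d a' - d b'"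
  then obtain a' b' where *: "a' \<noteq> 0" "b' \<noteq> 0" "Fract a b = Fract a' b'" "n = d a' - d b'" by blast
  then have "a * b' = a' * b" using assms by (simp add: eq_fract)
  then have "d a + d b' = d a' + d b" using * assms by (metis mult)
  then show "n = d a - d b" using * by simp
qed

lemma discrete_valuation_fract_val:
  assumes mult: "\<And>a b. a \<noteq> 0 \<Longrightarrow> b \<noteq> 0 \<Longrightarrow> d (a * b) = d a + d b"
    and add: "\<And>a b. a \<noteq> 0 \<Longrightarrow> b \<noteq> 0 \<Longrightarrow> a + b \<noteq> 0 \<Longrightarrow> min (d a) (d b) \<le> d (a + b)"
    and one: "a1 \<noteq> 0" "b1 \<noteq> 0" "d a1 - d b1 = 1"
  shows "discrete_valuation (fract_val d)"
  unfolding discrete_valuation_def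
proof (intro conjI allI impI)
  note val = fract_val_Fract[of d, OF mult]
  show "fract_val d (g * h) = fract_val d g + fract_val d h" if "g \<noteq> 0" "h \<noteq> 0" for g h
  proof (cases g rule: Fract_cases_nonzero; cases h rule: Fract_cases_nonzero)
    fix a b c e assume "g = Fract a b" "b \<noteq> 0" "a \<noteq> 0" "h = Fract c e" "e \<noteq> 0" "c \<noteq> 0"
    then show ?thesis by (simp add: val mult)
  qed (use that in auto)
  show "min (fract_val d g) (fract_val d h) \<le> fract_val d (g + h)" if "g \<noteq> 0" "h \<noteq> 0" "g + h \<noteq> 0" for g h
  proof (cases g rule: Fract_cases_nonzero; cases h rule: Fract_cases_nonzero)
    fix a b c e assume *: "g = Fract a b" "b \<noteq> 0" "a \<noteq> 0" "h = Fract c e" "e \<noteq> 0" "c \<noteq> 0"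
    then have "a * e + c * b \<noteq> 0" using that by (auto simp: fract_collapse)
    then show ?thesis using * add[of "a * e" "c * b"] by (simp add: val mult)
  qed (use that in auto)
  show "\<exists>g. g \<noteq> 0 \<and> fract_val d g = 1"
    using one by (intro exI[of _ "Fract a1 b1"]) (simp add: val Zero_fract_def eq_fract)
qed

definition place_at :: "'k::field poly \<Rightarrow> 'k poly fract \<Rightarrow> int"
  where "place_at f = fract_val (\<lambda>a. int (poly_ord f a))"

definition place_at_infinity :: "'k::field poly fract \<Rightarrow> int"
  where "place_at_infinity = fract_val (\<lambda>a. - int (degree a))"

text \<open>Monic polynomials serve as representatives of the classes of associated irreducible
  polynomials.\<close>

definition places :: "('k::field poly fract \<Rightarrow> int) set"
  where "places = insert place_at_infinity (place_at ` {f. irreducible f \<and> lead_coeff f = 1})"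

lemma place_at_Fract:
  "irreducible f \<Longrightarrow> a \<noteq> 0 \<Longrightarrow> b \<noteq> 0 \<Longrightarrow> place_at f (Fract a b) = int (poly_ord f a) - int (poly_ord f b)"
  unfolding place_at_def by (rule fract_val_Fract) (simp_all add: poly_ord_mult)

lemma place_at_infinity_Fract:
  "a \<noteq> 0 \<Longrightarrow> b \<noteq> 0 \<Longrightarrow> place_at_infinity (Fract a b) = int (degree b) - int (degree a)"
  unfolding place_at_infinity_def by (subst fract_val_Fract) (simp_all add: degree_mult_eq)

lemma valued_field_places:
  fixes v :: "'k::field poly fract \<Rightarrow> int"
  assumes "v \<in> places"
  shows "valued_field v"
proof
  consider "v = place_at_infinity" | f where "irreducible f" "v = place_at f"
    using assms unfolding places_def by blast
  then show "discrete_valuation v"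
  proof cases
    case 1
    show ?thesis
      unfolding 1 place_at_infinity_def
    \<comment> \<open>The reciprocal of the variable is a uniformizer at infinity.\<close>
    proof (rule discrete_valuation_fract_val[where ?a1.0 = 1 and ?b1.0 = "[:0, 1:]"])
      fix a b :: "'k poly"
      show "min (- int (degree a)) (- int (degree b)) \<le> - int (degree (a + b))"
        using degree_add_le_max[of a b] by linarith
    qed (simp_all add: degree_mult_eq)
  next
    case (2 f)
    then have "f \<noteq> 0" by auto
    then show ?thesis
      unfolding 2 place_at_def using 2(1) poly_ord_add[OF 2(1)]
      by (intro discrete_valuation_fract_val[where ?a1.0 = f and ?b1.0 = 1])
        (simp_all add: poly_ord_mult poly_ord_self of_nat_min[symmetric] del: of_nat_min)
  qed
qed

section \<open>Zeros and poles of rational functions\<close>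

lemma finite_places_nonzero:
  assumes "g \<noteq> 0"
  shows "finite {v \<in> places. v g \<noteq> 0}"
proof -
  obtain a b where g: "g = Fract a b" "a \<noteq> 0" "b \<noteq> 0"
    using assms by (cases g rule: Fract_cases_nonzero) auto
  let ?D = "\<lambda>a. {f. irreducible f \<and> lead_coeff f = 1 \<and> f dvd a}"
  have "{v \<in> places. v g \<noteq> 0} \<subseteq> insert place_at_infinity (place_at ` (?D a \<union> ?D b))"
  proof safe
    fix v assume v: "v \<in> places" "v g \<noteq> 0" "v \<notin> place_at ` (?D a \<union> ?D b)"
    have "place_at f g = 0" if f: "irreducible f" "\<not> f dvd a" "\<not> f dvd b" for f
      using f g by (simp add: place_at_Fract poly_ord_eq_0)
    then show "v = place_at_infinity" using v unfolding places_def by blast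
  qed
  then show ?thesis
    by (rule finite_subset)
      (intro finite.insertI finite_imageI finite_UnI finite_monic_irreducible_divisors g)
qed

lemma constant_val_ge:
  assumes "v \<in> places"
  shows "Fract [:c:] 1 \<in> val_ge v 0"
proof (cases "c = 0")
  case True
  then show ?thesis by (simp add: val_ge_def fract_collapse)
next
  case False
  have "poly_ord f [:c:] = 0" if "irreducible f" for f
  proof (rule poly_ord_eq_0[OF that])
    show "\<not> f dvd [:c:]"
      using irreducible_not_unit[OF that] False dvd_unit_imp_unit[of f "[:c:]"]
      by (auto simp: is_unit_const_poly_iff dvd_field_iff)
  qed
  then show ?thesis
    using assms False unfolding places_def val_ge_def
    by (auto simp: place_at_Fract place_at_infinity_Fract)
qed

text \<open>In a representation with denominator of least degree, a monic irreducible factor of the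
  denominator would divide the numerator too, by integrality at its place, and could be
  cancelled.\<close>

lemma polynomial_if_integral:
  assumes "\<And>f. irreducible f \<Longrightarrow> lead_coeff f = 1 \<Longrightarrow> g \<in> val_ge (place_at f) 0"
  shows "\<exists>a. g = Fract a 1"
proof (cases "g = 0")
  case True
  then show ?thesis by (intro exI[of _ 0]) (simp add: fract_collapse)
next
  case False
  define P where "P b \<longleftrightarrow> b \<noteq> 0 \<and> (\<exists>a. g = Fract a b)" for b
  have "\<exists>b. P b" using False unfolding P_def by (cases g rule: Fract_cases_nonzero) auto
  define b where "b = arg_min degree P"
  have "P b" and min: "\<And>c. P c \<Longrightarrow> degree b \<le> degree c"
    using \<open>\<exists>b. P b\<close> arg_min_nat_lemma[of P _ degree] by (auto simp: b_def)
  then obtain a where b: "b \<noteq> 0" and g: "g = Fract a b" by (auto simp: P_def)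
  have a: "a \<noteq> 0" using g False by (auto simp: fract_collapse)
  have "degree b = 0"
  proof (rule ccontr)
    assume "degree b \<noteq> 0"
    then obtain f where f: "irreducible f" "lead_coeff f = 1" "f dvd b"
      using monic_irreducible_divisor by blast
    have "poly_ord f b > 0" using f b by (simp add: poly_ord_pos_iff)
    moreover have "place_at f g \<ge> 0" using assms[OF f(1,2)] False by (simp add: val_ge_def)
    ultimately have "poly_ord f a > 0" using f a b by (simp add: g place_at_Fract)
    then have "f dvd a" using f a by (simp add: poly_ord_pos_iff)
    then obtain a' b' where *: "a = f * a'" "b = f * b'" using f(3) by (elim dvdE)
    have "f \<noteq> 0" using f(1) by auto
    then have "P b'" using g b * by (auto simp: P_def mult_fract_cancel)
    moreover have "degree b' < degree b"
      using * b irreducible_degree_pos[OF f(1)] by (simp add: degree_mult_eq)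
    ultimately show False using min by fastforce
  qed
  then obtain c where c: "b = [:c:]" "c \<noteq> 0" using b by (metis degree_eq_zeroE pCons_0_0)
  have "g = Fract (smult (inverse c) a) 1" using g c by (simp add: eq_fract)
  then show ?thesis by blast
qed

text \<open>This says that the Riemann--Roch spaces of \<open>K(t)\<close> have finite dimension.\<close>

lemma common_denominator_if_bounded_poles:
  fixes c :: "('k::field poly fract \<Rightarrow> int) \<Rightarrow> int"
  assumes c: "\<And>v. c v \<ge> 0" and fin: "finite {v \<in> places. c v \<noteq> 0}"
  obtains d m where "d \<noteq> 0"
    "\<And>g. (\<And>v. v \<in> places \<Longrightarrow> g \<in> val_ge v (- c v)) \<Longrightarrow> \<exists>a. degree a \<le> m \<and> g = Fract a d"
proof -
  \<comment> \<open>A polynomial with the required multiplicities at finitely many places is built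
    one place at a time.\<close>
  have "\<exists>d. d \<noteq> 0 \<and> (\<forall>f. irreducible f \<longrightarrow> place_at f \<in> S \<longrightarrow> c (place_at f) \<le> int (poly_ord f d))"
    if "finite S" for S
    using that
  proof (induction S rule: finite_induct)
    case empty
    show ?case by (intro exI[of _ 1]) simp
  next
    case (insert v S)
    then obtain d where d: "d \<noteq> 0"
      "\<And>f. irreducible f \<Longrightarrow> place_at f \<in> S \<Longrightarrow> c (place_at f) \<le> int (poly_ord f d)" by blast
    show ?case
    proof (cases "\<exists>f. irreducible f \<and> place_at f = v")
      case True
      then obtain f where f: "irreducible f" "place_at f = v" by blast
      define d' where "d' = f ^ nat (c v) * d"
      have f0: "f \<noteq> 0" using f(1) by auto
      have "d' \<noteq> 0" using f0 d(1) by (simp add: d'_def)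
      moreover have "c (place_at h) \<le> int (poly_ord h d')" if h: "irreducible h" "place_at h \<in> insert v S" for h
      proof (cases "place_at h \<in> S")
        case True
        then show ?thesis
          using d f0 h(1) by (force simp: d'_def poly_ord_mult)
      next
        case False
        then have v: "place_at h = place_at f" using h f by simp
        \<comment> \<open>Equality of the places gives \<open>f\<close> order \<open>1\<close> at
          \<open>h\<close> as well, so \<open>h\<close> divides \<open>f\<close> and the new factor
          of \<open>d'\<close> serves both.\<close>
        have "int (poly_ord h f) = place_at h (Fract f 1)"
          using f0 h(1) by (simp add: place_at_Fract)
        also have "\<dots> = 1"
          unfolding v using f(1) f0 by (simp add: place_at_Fract poly_ord_self)
        finally have "poly_ord h f > 0" by simp
        then have "h dvd f" using h f0 poly_ord_pos_iff[of h f] by simp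
        then have "h ^ nat (c v) dvd d'" unfolding d'_def by (simp add: dvd_power_same dvd_mult2)
        then have "nat (c v) \<le> poly_ord h d'" using h(1) \<open>d' \<noteq> 0\<close> by (intro poly_ord_ge)
        then show ?thesis using v f by simp
      qed
      ultimately show ?thesis by blast
    next
      case False
      then show ?thesis using d by (metis insertE)
    qed
  qed
  then obtain d where d: "d \<noteq> 0"
    "\<And>f. irreducible f \<Longrightarrow> place_at f \<in> places \<Longrightarrow> c (place_at f) \<noteq> 0 \<Longrightarrow> c (place_at f) \<le> int (poly_ord f d)"
    using fin by (metis (mono_tags, lifting) mem_Collect_eq)
  let ?D = "Fract d 1"
  have "\<exists>a. degree a \<le> nat (c place_at_infinity) + degree d \<and> g = Fract a d"
    if g: "\<And>v. v \<in> places \<Longrightarrow> g \<in> val_ge v (- c v)" for g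
  proof -
    \<comment> \<open>Multiplication by \<open>d\<close> clears the poles at all finite places, so
      the product is a polynomial; the place at infinity then bounds its degree.\<close>
    have "g * ?D \<in> val_ge (place_at f) 0" if f: "irreducible f" "lead_coeff f = 1" for f
    proof -
      have f': "place_at f \<in> places" using f by (simp add: places_def)
      interpret valued_field "place_at f" using valued_field_places[OF f'] .
      have "?D \<in> val_ge (place_at f) (c (place_at f))"
        using d(1) d(2)[OF f(1) f'] f(1) by (cases "c (place_at f) = 0") (auto simp: val_ge_def place_at_Fract)
      from val_ge_mult[OF g[OF f'] this] show ?thesis by simp
    qed
    then obtain a where a: "g * ?D = Fract a 1" using polynomial_if_integral by blast
    have "g = g * ?D * Fract 1 d" using d(1) by (simp add: mult.assoc fract_expand eq_fract)
    then have g_eq: "g = Fract a d" using a by simp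
    have "degree a \<le> nat (c place_at_infinity) + degree d"
    proof (cases "a = 0")
      case False
      have "place_at_infinity g \<ge> - c place_at_infinity"
        using g[of place_at_infinity] False d(1) by (auto simp: places_def val_ge_def g_eq Zero_fract_def eq_fract)
      then show ?thesis using False d(1) by (simp add: g_eq place_at_infinity_Fract)
    qed simp
    then show ?thesis using g_eq by blast
  qed
  then show thesis using d(1) that by blast
qed

section \<open>Finitely generated extensions of transcendence degree one\<close>

context field_extension
begin

section \<open>Finite bases of finitely generated algebraic extensions\<close>

lemma emb_sum: "emb (sum f A) = (\<Sum>i\<in>A. emb (f i))"
  by (induction A rule: infinite_finite_induct) (simp_all add: emb_add)

lemma is_subfield_range: "is_subfield (range emb)"
proof -
  have "emb x - emb y = emb (x + - y)" "emb x * emb y = emb (x * y)" "inverse (emb x) = emb (inverse x)" for x y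
    by (simp_all only: emb_add emb_minus emb_mult emb_inverse diff_conv_add_uminus)
  then show ?thesis
    unfolding is_subfield_def using emb_one by (auto intro: range_eqI[of 1 emb 1])
qed

lemma adjoin_subset: "is_subfield L \<Longrightarrow> range emb \<subseteq> L \<Longrightarrow> S \<subseteq> L \<Longrightarrow> adjoin S \<subseteq> L"
  unfolding adjoin_def by (rule hull_minimal) simp_all

lemma span_mult:
  assumes "x \<in> span A" "y \<in> span B"
  shows "x * y \<in> span ((\<lambda>(a, b). a * b) ` (A \<times> B))"
  using assms(1)
proof (induction rule: span_induct_alt)
  case (step c a x)
  have "a * y \<in> span ((\<lambda>(a, b). a * b) ` (A \<times> B))"
    using assms(2)
  proof (induction rule: span_induct_alt)
    case (step d b y)
    have "a * b \<in> span ((\<lambda>(a, b). a * b) ` (A \<times> B))"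
      using \<open>a \<in> A\<close> \<open>b \<in> B\<close> by (intro span_base) auto
    then have "emb d * (a * b) + a * y \<in> span ((\<lambda>(a, b). a * b) ` (A \<times> B))"
      using step by (intro span_add span_scale)
    then show ?case by (simp add: algebra_simps)
  qed (simp add: span_zero)
  then have "emb c * (a * y) + x * y \<in> span ((\<lambda>(a, b). a * b) ` (A \<times> B))"
    using step by (intro span_add span_scale)
  then show ?case by (simp add: algebra_simps)
qed (simp add: span_zero)

text \<open>Dividing by the leading coefficient of an annihilating polynomial expresses
  \<open>s ^ d\<close> through lower powers, so multiplication by \<open>s\<close> preserves their
  span.\<close>

lemma algebraic_powers_finite_span:
  assumes "algebraic_over (range emb) s"
  obtains d where "\<And>n. s ^ n \<in> span ((\<lambda>i. s ^ i) ` {..<d})"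
proof -
  obtain q where q: "q \<noteq> 0" "\<And>i. coeff q i \<in> range emb" "poly q s = 0"
    using assms unfolding algebraic_over_def by blast
  define d where "d = degree q"
  define V where "V = span ((\<lambda>i. s ^ i) ` {..<d})"
  have V: "subspace V" and pow: "\<And>i. i < d \<Longrightarrow> s ^ i \<in> V" unfolding V_def by (auto intro: span_base)
  have "\<forall>i. \<exists>g. coeff q i = emb g" using q(2) by blast
  then obtain g where g: "\<And>i. coeff q i = emb (g i)" by metis
  have gd: "emb (g d) \<noteq> 0" using q(1) by (simp add: d_def flip: g)
  have "s ^ d \<in> V"
  proof -
    have "(\<Sum>i<d. emb (g i) * s ^ i) + emb (g d) * s ^ d = 0"
      using q(3) by (simp add: poly_altdef g d_def flip: lessThan_Suc_atMost)
    then have "emb (g d) * s ^ d = - (\<Sum>i<d. emb (g i) * s ^ i)"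
      by (simp add: eq_neg_iff_add_eq_0 add.commute)
    moreover have "- (\<Sum>i<d. emb (g i) * s ^ i) \<in> V"
      using pow by (intro subspace_neg[OF V] subspace_sum[OF V] subspace_scale[OF V]) simp
    ultimately have "emb (g d) * s ^ d \<in> V" by (simp only:)
    then have "emb (inverse (g d)) * (emb (g d) * s ^ d) \<in> V"
      using V subspace_scale by blast
    moreover have "emb (inverse (g d)) * (emb (g d) * s ^ d) = s ^ d"
      using gd by (simp only: emb_inverse mult.assoc[symmetric] left_inverse[OF gd] mult_1_left)
    ultimately show ?thesis by (simp only:)
  qed
  then have pow': "s ^ i \<in> V" if "i \<le> d" for i using pow that by (cases "i = d") auto
  have mult_s: "s * x \<in> V" if "x \<in> V" for x
    using that unfolding V_def
  proof (induction rule: span_induct_alt)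
    case (step c a y)
    then obtain i where "i < d" "a = s ^ i" by auto
    then have "s * a \<in> V" using pow'[of "Suc i"] by simp
    then have "emb c * (s * a) + s * y \<in> V"
      using step V by (intro subspace_add subspace_scale) (simp_all add: V_def)
    then show ?case by (simp add: V_def algebra_simps)
  qed (simp add: span_zero)
  have "s ^ n \<in> V" for n
  proof (induction n)
    case 0
    show ?case using pow'[of 0] by simp
  next
    case (Suc n)
    then show ?case using mult_s by simp
  qed
  then show thesis using that unfolding V_def by blast
qed

text \<open>Elements of \<open>S\<close> are adjoined one at a time: the products of the old
  spanning set with finitely many powers of \<open>s\<close> span a ring again.\<close>

lemma finite_subring:
  assumes "finite S" and alg: "\<And>x. algebraic_over (range emb) x"
  shows "\<exists>B. finite B \<and> 1 \<in> span B \<and> S \<subseteq> span B \<and> (\<forall>x\<in>span B. \<forall>y\<in>span B. x * y \<in> span B)"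
  using assms(1)
proof (induction S rule: finite_induct)
  case empty
  have "\<forall>x\<in>span {1}. \<forall>y\<in>span {1}. x * y \<in> span {1}"
    using span_mult[of _ "{1}" _ "{1}"] by simp
  then show ?case by (intro exI[of _ "{1}"]) (simp add: span_base)
next
  case (insert s S)
  then obtain B where B: "finite B" "1 \<in> span B" "S \<subseteq> span B"
    and mult: "\<And>x y. x \<in> span B \<Longrightarrow> y \<in> span B \<Longrightarrow> x * y \<in> span B"
    by blast
  obtain d where d: "\<And>n. s ^ n \<in> span ((\<lambda>i. s ^ i) ` {..<d})"
    using algebraic_powers_finite_span[OF alg] by blast
  define P where "P = (\<lambda>i. s ^ i) ` {..<d}"
  define C where "C = (\<lambda>(a, b). a * b) ` (B \<times> P)"
  have BP: "x * s ^ n \<in> span C" if "x \<in> span B" for x n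
    unfolding C_def P_def using that d by (rule span_mult)
  have prod: "c * c' \<in> span C" if "c \<in> C" "c' \<in> C" for c c'
  proof -
    from that obtain b b' i j where "b \<in> B" "b' \<in> B" "c = b * s ^ i" "c' = b' * s ^ j"
      unfolding C_def P_def by auto
    then have "b * b' * s ^ (i + j) \<in> span C" by (intro BP mult span_base)
    then show ?thesis using \<open>c = _\<close> \<open>c' = _\<close> by (simp add: power_add algebra_simps)
  qed
  have "x * y \<in> span C" if "x \<in> span C" "y \<in> span C" for x y
  proof -
    have "(\<lambda>(a, b). a * b) ` (C \<times> C) \<subseteq> span C" using prod by auto
    then show ?thesis using span_mult[OF that] span_minimal[OF _ subspace_span] by blast
  qed
  moreover have "finite C" unfolding C_def P_def using B(1) by simp
  moreover have "1 \<in> span C" "s \<in> span C" using BP[OF B(2), of 0] BP[OF B(2), of 1] by simp_all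
  moreover have "S \<subseteq> span C" using BP[of _ 0] B(3) by auto
  ultimately show ?case by blast
qed

text \<open>Factors of the variable are stripped from an annihilating polynomial until its constant
  term \<open>a\<close> is nonzero; then \<open>a + x * poly q x = 0\<close> exhibits the inverse as
  a polynomial in \<open>x\<close>.\<close>

lemma inverse_in_subring:
  assumes R: "subspace R" "1 \<in> R" and mult: "\<And>x y. x \<in> R \<Longrightarrow> y \<in> R \<Longrightarrow> x * y \<in> R"
    and x: "x \<in> R" "algebraic_over (range emb) x"
  shows "inverse x \<in> R"
proof -
  have poly_R: "poly q x \<in> R" if "\<And>i. coeff q i \<in> range emb" for q
  proof -
    have "x ^ i \<in> R" for i by (induction i) (use R mult x in auto)
    then have "coeff q i * x ^ i \<in> R" for i
      using that[of i] R(1) subspace_scale by fastforce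
    then show ?thesis unfolding poly_altdef using R(1) by (intro subspace_sum)
  qed
  have "inverse x \<in> R" if "q \<noteq> 0" "\<And>i. coeff q i \<in> range emb" "poly q x = 0" for q
    using that
  proof (induction q rule: pCons_induct)
    case (pCons a q)
    have q: "coeff q i \<in> range emb" for i using pCons.prems(2)[of "Suc i"] by simp
    show ?case
    proof (cases "a = 0")
      case True
      show ?thesis
      proof (cases "x = 0")
        case False
        then show ?thesis using pCons q True by simp
      qed (use R subspace_0 in simp)
    next
      case False
      obtain c where c: "a = emb c" using pCons.prems(2)[of 0] by auto
      have "x * (- poly q x / a) = 1"
        using pCons.prems(3) False by (simp add: field_simps) (metis add.inverse_unique minus_minus)
      then have "inverse x = - poly q x / a" by (metis inverse_unique)
      also have "\<dots> = emb (- inverse c) * poly q x"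
        by (simp add: c emb_minus emb_inverse divide_inverse)
      finally show ?thesis using poly_R[OF q] R(1) subspace_scale by presburger
    qed
  qed simp
  then show ?thesis using x(2) unfolding algebraic_over_def by blast
qed

text \<open>A finite-dimensional subring containing \<open>S\<close> is a field because all its
  elements are algebraic, hence it is everything.\<close>

lemma finite_basis:
  assumes S: "finite S" "\<And>L. is_subfield L \<Longrightarrow> range emb \<subseteq> L \<Longrightarrow> S \<subseteq> L \<Longrightarrow> L = UNIV"
    and alg: "\<And>x. algebraic_over (range emb) x"
  obtains E where "finite E" "independent E" "span E = UNIV"
proof -
  obtain B where B: "finite B" "1 \<in> span B" "S \<subseteq> span B"
    "\<And>x y. x \<in> span B \<Longrightarrow> y \<in> span B \<Longrightarrow> x * y \<in> span B"
    using finite_subring[OF S(1) alg] by blast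
  have "is_subfield (span B)"
    unfolding is_subfield_def using B inverse_in_subring[of "span B"] alg
    by (auto intro: span_diff)
  moreover have "range emb \<subseteq> span B" using span_scale[OF B(2)] by auto
  ultimately have span_B: "span B = UNIV" using B(3) S(2) by blast
  obtain E where E: "E \<subseteq> B" "independent E" "B \<subseteq> span E"
    using maximal_independent_subset by blast
  have "span B \<subseteq> span E" using E(3) by (intro span_minimal subspace_span)
  then show thesis using that[of E] E B(1) span_B finite_subset by blast
qed

section \<open>Embedding the rational function field\<close>

definition ev :: "'f \<Rightarrow> 'k poly \<Rightarrow> 'f"
  where "ev t a = poly (map_poly emb a) t"

lemma ev_add: "ev t (a + b) = ev t a + ev t b"
proof -
  have "map_poly emb (a + b) = map_poly emb a + map_poly emb b"
    by (rule poly_eqI) (simp add: coeff_map_poly emb_add)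
  then show ?thesis by (simp add: ev_def)
qed

lemma ev_mult: "ev t (a * b) = ev t a * ev t b"
proof -
  have "map_poly emb (a * b) = map_poly emb a * map_poly emb b"
    by (rule poly_eqI) (simp add: coeff_map_poly coeff_mult emb_sum emb_mult)
  then show ?thesis by (simp add: ev_def)
qed

lemma ev_const: "ev t [:c:] = emb c"
  by (simp add: ev_def map_poly_pCons)

lemma ev_X: "ev t [:0, 1:] = t"
  by (simp add: ev_def map_poly_pCons emb_one)

lemma ev_0 [simp]: "ev t 0 = 0" and ev_1 [simp]: "ev t 1 = 1"
  using ev_const[of t 0] ev_const[of t 1] by (simp_all add: emb_one one_pCons)

lemma ev_altdef: "ev t a = (\<Sum>i\<le>degree a. emb (coeff a i) * t ^ i)"
proof -
  have "degree (map_poly emb a) = degree a" by (rule degree_map_poly) simp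
  then show ?thesis by (simp add: ev_def poly_altdef coeff_map_poly)
qed

text \<open>The polynomial \<open>a\<close> is translated into the finitely supported map
  \<open>P\<close> on monomials in the single variable \<open>t\<close>; injectivity of
  \<open>M\<close> lets the coefficients be read off again.\<close>

lemma ev_eq_0_iff:
  assumes "algebraically_independent {t}"
  shows "ev t a = 0 \<longleftrightarrow> a = 0"
proof
  assume ev: "ev t a = 0"
  define M where "M i = Poly_Mapping.single t i" for i :: nat
  have inj: "inj M" unfolding M_def by (rule injI) (metis lookup_single_eq)
  define P where "P = (\<Sum>i\<le>degree a. Poly_Mapping.single (M i) (coeff a i))"
  have "Poly_Mapping.lookup P m = (\<Sum>i\<le>degree a. if M i = m then coeff a i else 0)" for m
    by (simp add: P_def Poly_Mapping.lookup_sum lookup_single when_def)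
  then have lookup_M: "Poly_Mapping.lookup P (M i) = coeff a i" for i
    using inj by (simp add: inj_eq coeff_eq_0)
  have keys: "Poly_Mapping.keys P \<subseteq> M ` {..degree a}"
    unfolding P_def by (rule order.trans[OF keys_sum]) (auto split: if_splits)
  have monomial: "(\<Prod>s\<in>Poly_Mapping.keys (M i). s ^ Poly_Mapping.lookup (M i) s) = t ^ i" for i
    by (cases "i = 0") (simp_all add: M_def)
  have "poly_eval P = (\<Sum>m\<in>M ` {..degree a}. emb (Poly_Mapping.lookup P m) * (\<Prod>s\<in>Poly_Mapping.keys m. s ^ Poly_Mapping.lookup m s))"
    unfolding poly_eval_def using keys by (intro sum.mono_neutral_left) (auto simp: in_keys_iff)
  also have "\<dots> = ev t a"
    unfolding sum.reindex[OF inj_on_subset[OF inj subset_UNIV]] o_def lookup_M monomial ev_altdef ..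
  finally have "poly_eval P = 0" using ev by simp
  moreover have "\<forall>m\<in>Poly_Mapping.keys P. Poly_Mapping.keys m \<subseteq> {t}" using keys by (auto simp: M_def split: if_splits)
  ultimately have "P = 0" using assms unfolding algebraically_independent_def by blast
  then show "a = 0" using lookup_M by (metis lookup_zero poly_eqI coeff_0)
qed simp

text \<open>The extension of \<open>ev t\<close> to fractions. For transcendental \<open>t\<close>
  the value does not depend on the representation.\<close>

definition fract_emb :: "'f \<Rightarrow> 'k poly fract \<Rightarrow> 'f"
  where "fract_emb t g = (SOME z. \<exists>a b. b \<noteq> 0 \<and> g = Fract a b \<and> z = ev t a / ev t b)"

lemma fract_emb_Fract:
  assumes t: "algebraically_independent {t}" and b: "b \<noteq> 0"
  shows "fract_emb t (Fract a b) = ev t a / ev t b"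
  unfolding fract_emb_def
proof (rule some1_equality, rule ex1I)
  show *: "\<exists>a' b'. b' \<noteq> 0 \<and> Fract a b = Fract a' b' \<and> ev t a / ev t b = ev t a' / ev t b'"
    using b by blast
  then show "\<exists>a' b'. b' \<noteq> 0 \<and> Fract a b = Fract a' b' \<and> ev t a / ev t b = ev t a' / ev t b'" .
  fix z assume "\<exists>a' b'. b' \<noteq> 0 \<and> Fract a b = Fract a' b' \<and> z = ev t a' / ev t b'"
  then obtain a' b' where *: "b' \<noteq> 0" "Fract a b = Fract a' b'" "z = ev t a' / ev t b'" by blast
  then have "a * b' = a' * b" using b by (simp add: eq_fract)
  then have "ev t a * ev t b' = ev t a' * ev t b" by (metis ev_mult)
  moreover have "z * ev t b' = ev t a'" using * by (simp add: ev_eq_0_iff[OF t])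
  ultimately have "ev t b' * (z * ev t b) = ev t b' * ev t a" by (metis mult.assoc mult.commute)
  then have "z * ev t b = ev t a" using * by (simp only: mult_left_cancel ev_eq_0_iff[OF t] not_False_eq_True)
  then show "z = ev t a / ev t b" using b by (simp add: ev_eq_0_iff[OF t] field_simps)
qed

lemma field_extension_fract_emb:
  assumes t: "algebraically_independent {t}"
  shows "field_extension (fract_emb t)"
proof
  note [simp] = fract_emb_Fract[OF t] ev_eq_0_iff[OF t]
  show "fract_emb t (x + y) = fract_emb t x + fract_emb t y" for x y
    by (cases x; cases y) (simp add: ev_add ev_mult field_simps)
  show "fract_emb t (x * y) = fract_emb t x * fract_emb t y" for x y
    by (cases x; cases y) (simp add: ev_mult)
  show "fract_emb t 1 = 1"
    by (simp add: One_fract_def)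
qed

lemma adjoin_subset_range_fract_emb:
  assumes t: "algebraically_independent {t}"
  shows "adjoin {t} \<subseteq> range (fract_emb t)"
proof (rule adjoin_subset)
  interpret G: field_extension "fract_emb t" using t by (rule field_extension_fract_emb)
  show "is_subfield (range (fract_emb t))" by (rule G.is_subfield_range)
  have "fract_emb t (Fract [:c:] 1) = emb c" for c
    by (simp add: fract_emb_Fract[OF t] ev_const)
  then show "range emb \<subseteq> range (fract_emb t)" by (metis image_subsetI rangeI)
  have "fract_emb t (Fract [:0, 1:] 1) = t"
    by (simp add: fract_emb_Fract[OF t] ev_X)
  then show "{t} \<subseteq> range (fract_emb t)" by (metis empty_subsetI insert_subset rangeI)
qed

lemma algebraic_if_powers_in_finite_span:
  assumes "finite W" "\<And>j. x ^ j \<in> span W"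
  shows "algebraic_over (range emb) x"
proof -
  obtain g where g: "\<exists>i\<in>{..card W}. g i \<noteq> 0" "(\<Sum>i\<in>{..card W}. emb (g i) * x ^ i) = 0"
    by (rule powers_dependent[OF assms, where I = "{..card W}"]) simp_all
  define r where "r = (\<Sum>i\<le>card W. monom (emb (g i)) i)"
  have coeff_r: "coeff r i = (if i \<le> card W then emb (g i) else 0)" for i
    by (simp add: r_def coeff_sum)
  have "r \<noteq> 0"
  proof
    assume "r = 0"
    then show False using g(1) coeff_r by (metis atMost_iff coeff_0 emb_eq_0_iff)
  qed
  moreover have "coeff r i \<in> range emb" for i
    using coeff_r emb_0 by (metis rangeI)
  moreover have "poly r x = 0"
    using g(2) by (simp add: r_def poly_sum poly_monom)
  ultimately show ?thesis unfolding algebraic_over_def by blast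
qed

end

section \<open>The index of an algebraic function\<close>

text \<open>Ordering functions with finite support by their largest support element, and then by the
  value there, is ultrametric for the pointwise maximum, whereas the full lexicographic order is not.\<close>

lemma leading_term_index:
  fixes n :: "'i \<Rightarrow> 'x \<Rightarrow> nat"
  assumes fin: "\<And>x. finite {v. n v x \<noteq> 0}"
  obtains R :: "('i \<times> nat) rel" and idx :: "'x \<Rightarrow> 'i \<times> nat" where
    "wf R" "trans R" "total R"
    "\<And>x y z i. (idx x, i) \<in> R\<^sup>= \<Longrightarrow> (idx y, i) \<in> R\<^sup>= \<Longrightarrow>
      (\<And>v. n v z \<le> max (n v x) (n v y)) \<Longrightarrow> (idx z, i) \<in> R\<^sup>="
    "\<And>x y. \<exists>v. n v x \<noteq> 0 \<Longrightarrow> (\<And>v. n v x \<noteq> 0 \<Longrightarrow> n v x < n v y) \<Longrightarrow> (idx x, idx y) \<in> R"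
proof -
  obtain r :: "'i rel" where r: "well_order_on UNIV r"
    using well_order_on by blast
  define W where "W = r - Id"
  have wf_W: "wf W" and trans_W: "trans W" and total_W: "\<And>v w. v \<noteq> w \<Longrightarrow> (v, w) \<in> W \<or> (w, v) \<in> W"
    using r unfolding W_def well_order_on_def linear_order_on_def partial_order_on_def preorder_on_def
    by (auto intro: trans_diff_Id simp: total_on_def)
  \<comment> \<open>The least element \<open>v0\<close> serves for the index \<open>(v0, 0)\<close>
    of a function without support, which lies below every other pair.\<close>
  obtain v0 where v0: "\<And>w. w \<noteq> v0 \<Longrightarrow> (v0, w) \<in> W"
    using wf_W total_W by (metis UNIV_I wfE_min)
  have "\<exists>w. n w x \<noteq> 0 \<and> (\<forall>u. (w, u) \<in> W \<longrightarrow> n u x = 0)" if "\<exists>v. n v x \<noteq> 0" for x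
  proof -
    let ?S = "{v. n v x \<noteq> 0}"
    \<comment> \<open>On a finite support the converse order is well-founded, which yields a largest
      support element.\<close>
    have "acyclic (Restr (W\<inverse>) ?S)"
      using wf_acyclic[OF wf_W] by (rule acyclic_subset[OF acyclic_converse[THEN iffD2]]) blast
    moreover have "finite (Restr (W\<inverse>) ?S)"
      using fin[of x] by (intro finite_Int) simp
    ultimately have wf: "wf (Restr (W\<inverse>) ?S)" by (intro finite_acyclic_wf)
    from that obtain v where "v \<in> ?S" by blast
    then show ?thesis by (rule wfE_min[OF wf]) blast
  qed
  then obtain top where top: "\<And>x v. n v x \<noteq> 0 \<Longrightarrow> n (top x) x \<noteq> 0"
    "\<And>x v u. n v x \<noteq> 0 \<Longrightarrow> (top x, u) \<in> W \<Longrightarrow> n u x = 0"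
    by metis
  define idx where "idx x = (if \<exists>v. n v x \<noteq> 0 then (top x, n (top x) x) else (v0, 0))" for x
  define R where "R = W <*lex*> less_than"
  \<comment> \<open>Being at most \<open>(w, k)\<close> means vanishing above \<open>w\<close> and
    being at most \<open>k\<close> at \<open>w\<close>. Both conditions survive pointwise maxima,
    which is the ultrametric property.\<close>
  have le_iff: "(idx x, (w, k)) \<in> R\<^sup>= \<longleftrightarrow> n w x \<le> k \<and> (\<forall>u. (w, u) \<in> W \<longrightarrow> n u x = 0)" for x w k
  proof (cases "\<exists>v. n v x \<noteq> 0")
    case True
    then have idx: "idx x = (top x, n (top x) x)" by (simp add: idx_def)
    have top_x: "n (top x) x \<noteq> 0" "\<And>u. (top x, u) \<in> W \<Longrightarrow> n u x = 0"
      using True top by blast+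
    show ?thesis
    proof
      assume "(idx x, (w, k)) \<in> R\<^sup>="
      then consider "(top x, w) \<in> W" | "top x = w" "n w x \<le> k"
        by (auto simp: idx R_def)
      then show "n w x \<le> k \<and> (\<forall>u. (w, u) \<in> W \<longrightarrow> n u x = 0)"
        using top_x trans_W by cases (auto dest: transD)
    next
      assume *: "n w x \<le> k \<and> (\<forall>u. (w, u) \<in> W \<longrightarrow> n u x = 0)"
      then have "(w, top x) \<notin> W" using top_x(1) by force
      then have "top x = w \<or> (top x, w) \<in> W" using total_W by blast
      then show "(idx x, (w, k)) \<in> R\<^sup>=" using * by (auto simp: idx R_def)
    qed
  next
    case False
    then show ?thesis using v0[of w] by (auto simp: idx_def R_def)
  qed
  have wf_R: "wf R" unfolding R_def using wf_W by blast
  have trans_R: "trans R" unfolding R_def using trans_W by (intro trans_lex_prod trans_less_than)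
  have "total W" using total_W by (simp add: total_on_def)
  then have total_R: "total R" unfolding R_def by (intro total_lex_prod total_less_than)
  show thesis
  proof (rule that[OF wf_R trans_R total_R])
    fix x y z i
    assume "(idx x, i) \<in> R\<^sup>=" "(idx y, i) \<in> R\<^sup>=" and z: "\<And>v. n v z \<le> max (n v x) (n v y)"
    moreover obtain w k where i: "i = (w, k)" by fastforce
    ultimately have x: "n w x \<le> k" "\<And>u. (w, u) \<in> W \<Longrightarrow> n u x = 0"
      and y: "n w y \<le> k" "\<And>u. (w, u) \<in> W \<Longrightarrow> n u y = 0"
      by (simp_all only: le_iff)
    have "n w z \<le> k" using z[of w] x(1) y(1) by simp
    moreover have "n u z = 0" if "(w, u) \<in> W" for u
      using z[of u] x(2)[OF that] y(2)[OF that] by simp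
    ultimately show "(idx z, i) \<in> R\<^sup>=" unfolding i le_iff by blast
  next
    fix x y
    assume ex: "\<exists>v. n v x \<noteq> 0" and less: "\<And>v. n v x \<noteq> 0 \<Longrightarrow> n v x < n v y"
    then have idx: "idx x = (top x, n (top x) x)" by (simp add: idx_def)
    have "n (top x) x \<noteq> 0" using ex top by blast
    \<comment> \<open>At the leading position of \<open>x\<close> the value of \<open>y\<close> is
      larger, so the index of \<open>y\<close> is not at most that of \<open>x\<close>; totality
      does the rest.\<close>
    then have "\<not> n (top x) y \<le> n (top x) x" using less by (simp add: not_le)
    then have "(idx y, idx x) \<notin> R\<^sup>=" unfolding idx le_iff by blast
    then show "(idx x, idx y) \<in> R" using total_R unfolding total_on_def by blast
  qed
qed

locale function_field = finite_extension tau E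
  for tau :: "'k::field poly fract \<Rightarrow> 'f::field" and E
begin

section \<open>Poles of elements of the function field\<close>

lemma valued_extension_places: "v \<in> places \<Longrightarrow> valued_extension tau E v"
  by (intro valued_extension.intro finite_extension_axioms valued_field_places)

text \<open>The set \<open>A\<close> holds the matrix entries of multiplication by \<open>x\<close>
  and the coordinates of \<open>1\<close>. Outside the places where some nonzero one of them has
  nonzero valuation, \<open>powers_in_lattice\<close> applies.\<close>

lemma finite_bad_places: "\<exists>T. finite T \<and> (\<forall>v\<in>places - T. \<forall>j. x ^ j \<in> lattice v 0)"
proof -
  define A where "A = (\<lambda>(e, f). representation E (x * e) f) ` (E \<times> E) \<union> representation E 1 ` E"
  define T where "T = (\<Union>g\<in>A - {0}. {v \<in> places. v g \<noteq> 0})"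
  have "finite T"
    unfolding T_def A_def using finite_E by (auto intro!: finite_places_nonzero)
  moreover have "x ^ j \<in> lattice v 0" if v: "v \<in> places - T" for v j
  proof -
    interpret valued_extension tau E v using v by (intro valued_extension_places) simp
    have "g \<in> val_ge v 0" if "g \<in> A" for g
      using v that unfolding T_def val_ge_def by force
    then show ?thesis
      by (intro powers_in_lattice) (auto simp: lattice_def A_def)
  qed
  ultimately show ?thesis by blast
qed

lemma finite_poles: "finite {v \<in> places. pole_order v x \<noteq> 0}"
proof -
  obtain T where T: "finite T" "\<And>v j. v \<in> places - T \<Longrightarrow> x ^ j \<in> lattice v 0"
    using finite_bad_places[of x] by blast
  have "v \<in> T" if v: "v \<in> places" "pole_order v x \<noteq> 0" for v
  proof (rule ccontr)
    assume "v \<notin> T"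
    interpret valued_extension tau E v using v(1) by (rule valued_extension_places)
    have "x \<in> integers v" using T(2) v(1) \<open>v \<notin> T\<close> by (intro integersI[of x 0]) simp
    then show False using v(2) by (simp add: pole_order_eq_0_iff)
  qed
  then have "{v \<in> places. pole_order v x \<noteq> 0} \<subseteq> T" by auto
  then show ?thesis using T(1) by (rule finite_subset)
qed

text \<open>Integrality gives a separate bound at each of the finitely many bad places, and
  elsewhere the bound is \<open>0\<close>. Hence the coordinates of all powers of \<open>x\<close>
  have poles bounded by one divisor.\<close>

lemma bounded_powers_if_no_poles:
  assumes "\<And>v. v \<in> places \<Longrightarrow> pole_order v x = 0"
  shows "\<exists>c. (\<forall>v. c v \<ge> 0) \<and> finite {v \<in> places. c v \<noteq> 0} \<and>
    (\<forall>v\<in>places. \<forall>j. x ^ j \<in> lattice v (c v))"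
proof -
  obtain T where T: "finite T" "\<And>v j. v \<in> places - T \<Longrightarrow> x ^ j \<in> lattice v 0"
    using finite_bad_places[of x] by blast
  have "\<exists>c\<ge>0. (\<forall>j. x ^ j \<in> lattice v c) \<and> (v \<notin> T \<longrightarrow> c = 0)" if v: "v \<in> places" for v
  proof (cases "v \<in> T")
    case True
    interpret valued_extension tau E v using v by (rule valued_extension_places)
    obtain c where "\<And>j. x ^ j \<in> lattice v c"
      using assms[OF v] unfolding pole_order_eq_0_iff by (metis integersE)
    then have "\<forall>j. x ^ j \<in> lattice v (max c 0)" by (auto intro: lattice_mono[of _ c])
    then show ?thesis using True by (intro exI[of _ "max c 0"]) simp
  qed (use T(2) v in blast)
  then obtain c where c: "\<And>v. v \<in> places \<Longrightarrow> c v \<ge> 0"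
    "\<And>v j. v \<in> places \<Longrightarrow> x ^ j \<in> lattice v (c v)" "\<And>v. v \<in> places \<Longrightarrow> v \<notin> T \<Longrightarrow> c v = 0"
    by metis
  define c' where "c' v = (if v \<in> places then c v else 0)" for v
  have "{v \<in> places. c' v \<noteq> 0} \<subseteq> T"
    using c(3) by (auto simp: c'_def)
  then have "finite {v \<in> places. c' v \<noteq> 0}" using T(1) by (rule finite_subset)
  then show ?thesis using c by (intro exI[of _ c']) (simp add: c'_def)
qed

end

section \<open>The index by poles on a function field\<close>

theorem theorem10:
  fixes emb :: "'k::field \<Rightarrow> 'f::field" and p :: nat
  assumes "field_extension emb"
    and "CHAR('k) = p" and "p > 0"
    and "perfect_field TYPE('k)"
    and "field_extension.finitely_generated emb"
    and "field_extension.has_transcendence_degree emb 1"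
    and "field_extension.relatively_algebraically_closed emb"
  shows "\<exists>B. field_extension.is_basis emb B \<and> frobenius_closed p B"
proof -
  interpret field_extension emb by fact
  interpret frobenius_extension emb p
    using assms by unfold_locales
  obtain t where t: "algebraically_independent {t}" and alg: "\<And>x. algebraic_over (adjoin {t}) x"
    using assms(6) unfolding has_transcendence_degree_def transcendence_basis_def
    by (metis card_1_singletonE)
  define tau where "tau = fract_emb t"
  have tau: "tau (Fract a b) = ev t a / ev t b" if "b \<noteq> 0" for a b
    unfolding tau_def using t that by (rule fract_emb_Fract)
  have tau_const: "tau (Fract [:c:] 1) = emb c" for c
    by (simp add: tau ev_const)
  interpret G: field_extension tau
    unfolding tau_def using t by (rule field_extension_fract_emb)
  obtain S where S: "finite S" "adjoin S = UNIV"
    using assms(5) unfolding finitely_generated_def by blast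
  have emb_subset: "range emb \<subseteq> range tau" using tau_const by (metis image_subsetI rangeI)
  \<comment> \<open>Generators of \<open>F\<close> over \<open>K\<close> also generate it over the
    larger field \<open>K(t)\<close>, over which every element is algebraic.\<close>
  obtain E where E: "finite E" "G.independent E" "G.span E = UNIV"
  proof (rule G.finite_basis[OF S(1)])
    show "L = UNIV" if "is_subfield L" "range tau \<subseteq> L" "S \<subseteq> L" for L
      using adjoin_subset[of L S] that emb_subset S(2) by blast
    show "algebraic_over (range tau) x" for x
      using alg[of x] adjoin_subset_range_fract_emb[OF t] unfolding algebraic_over_def tau_def
      by blast
  qed
  interpret F: function_field tau E
    by (intro function_field.intro finite_extension.intro finite_extension_axioms.intro
        G.field_extension_axioms E)
  \<comment> \<open>The coordinates of all powers of \<open>x\<close> have a common denominator and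
    numerators of bounded degree, so these powers lie in a finite-dimensional \<open>K\<close>-space
    and \<open>x\<close> is algebraic over \<open>K\<close>.\<close>
  have no_poles: "x \<in> range emb" if no_poles: "\<And>v. v \<in> places \<Longrightarrow> F.pole_order v x = 0" for x
  proof -
    obtain c where c: "\<And>v. c v \<ge> 0" "finite {v \<in> places. c v \<noteq> 0}"
      "\<And>v j. v \<in> places \<Longrightarrow> x ^ j \<in> F.lattice v (c v)"
      using F.bounded_powers_if_no_poles[of x] no_poles by blast
    obtain d m where d: "d \<noteq> 0"
      "\<And>g. (\<And>v. v \<in> places \<Longrightarrow> g \<in> val_ge v (- c v)) \<Longrightarrow> \<exists>a. degree a \<le> m \<and> g = Fract a d"
      by (rule common_denominator_if_bounded_poles[of c]) (use c in auto)
    define W where "W = (\<lambda>(k, e). t ^ k / ev t d * e) ` ({..m} \<times> E)"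
    have "x ^ j \<in> span W" for j
    proof -
      have "tau (G.representation E (x ^ j) e) * e \<in> span W" if e: "e \<in> E" for e
      proof -
        have "\<exists>a. degree a \<le> m \<and> G.representation E (x ^ j) e = Fract a d"
          using c(3) e by (intro d(2)) (auto simp: F.lattice_def)
        then obtain a where a: "degree a \<le> m" "G.representation E (x ^ j) e = Fract a d" by blast
        have "(\<Sum>k\<le>degree a. emb (coeff a k) * (t ^ k / ev t d * e)) \<in> span W"
          using a(1) e by (intro span_sum span_scale span_base) (auto simp: W_def)
        also have "(\<Sum>k\<le>degree a. emb (coeff a k) * (t ^ k / ev t d * e)) = ev t a / ev t d * e"
          unfolding ev_altdef[of t a] by (simp add: sum_divide_distrib sum_distrib_right mult.assoc)
        finally show ?thesis using a(2) d(1) by (simp add: tau)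
      qed
      then have "(\<Sum>e\<in>E. tau (G.representation E (x ^ j) e) * e) \<in> span W" by (rule span_sum)
      then show ?thesis by (simp add: F.representation_expand)
    qed
    moreover have "finite W" unfolding W_def using E(1) by simp
    ultimately have "algebraic_over (range emb) x" by (intro algebraic_if_powers_in_finite_span)
    then show ?thesis using assms(7) unfolding relatively_algebraically_closed_def by blast
  qed
  \<comment> \<open>Extension by zero outside \<open>places\<close> makes the family indexed by a
    whole type, as \<open>leading_term_index\<close> requires.\<close>
  define n where "n v x = (if v \<in> places then F.pole_order v x else 0)" for v x
  have fin: "finite {v. n v x \<noteq> 0}" for x
    using F.finite_poles[of x] by (rule finite_subset[rotated]) (auto simp: n_def split: if_splits)
  have n_add: "n v (x + y) \<le> max (n v x) (n v y)" for v x y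
  proof (cases "v \<in> places")
    case True
    interpret valued_extension tau E v using True by (rule F.valued_extension_places)
    show ?thesis using True pole_order_add by (simp add: n_def)
  qed (simp add: n_def)
  have n_scale: "n v (emb c * x) \<le> n v x" for v c x
  proof (cases "v \<in> places")
    case True
    interpret valued_extension tau E v using True by (rule F.valued_extension_places)
    show ?thesis using True pole_order_scale[OF constant_val_ge[OF True]] by (simp add: n_def tau_const)
  qed (simp add: n_def)
  have n_power: "n v x < n v (x ^ p)" if "n v x \<noteq> 0" for v x
  proof -
    have v: "v \<in> places" using that by (auto simp: n_def split: if_splits)
    interpret valued_extension tau E v using v by (rule F.valued_extension_places)
    show ?thesis using that pole_order_power[OF p_ge_2] by (simp add: n_def v)
  qed
  obtain R :: "(('k poly fract \<Rightarrow> int) \<times> nat) rel" and idx where R: "wf R" "trans R" "total R"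
    and ultra: "\<And>x y z i. (idx x, i) \<in> R\<^sup>= \<Longrightarrow> (idx y, i) \<in> R\<^sup>= \<Longrightarrow>
      (\<And>v. n v z \<le> max (n v x) (n v y)) \<Longrightarrow> (idx z, i) \<in> R\<^sup>="
    and less: "\<And>x y. \<exists>v. n v x \<noteq> 0 \<Longrightarrow> (\<And>v. n v x \<noteq> 0 \<Longrightarrow> n v x < n v y) \<Longrightarrow> (idx x, idx y) \<in> R"
    using leading_term_index[of n, OF fin] by blast
  show ?thesis
  proof (rule frobenius_basis_if_ultrametric[OF R])
    show "(idx (x + y), i) \<in> R\<^sup>=" if "(idx x, i) \<in> R\<^sup>=" "(idx y, i) \<in> R\<^sup>=" for x y i
      using that n_add by (rule ultra)
    show "(idx (emb c * x), idx x) \<in> R\<^sup>=" for c x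
      by (rule ultra[of x "idx x" x]) (simp_all only: pair_in_Id_conv Un_iff simp_thms max.idem n_scale)
    show "(idx y, idx (y ^ p)) \<in> R" if "y \<notin> range emb" for y
    proof (rule less)
      have "\<exists>v\<in>places. F.pole_order v y \<noteq> 0" using no_poles[of y] that by blast
      then show "\<exists>v. n v y \<noteq> 0" by (auto simp: n_def)
    qed (rule n_power)
  qed
qed

end
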